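(* For every integer $n\geq 1$ we have $\mathcal{TC}(\mathrm{RL}_n^V)=\mathrm{CS}$.
   Context: A right-linear grammar is $G=(N,T,P,S)$ with finite non-terminal set $N$, terminal set $T$, start symbol $S\in N$ and finite rule set $P$ consisting of rules $A\to wB$ or $A\to w$ with $A,B\in N$, $w\in T^*$. For a regular language $L$, $\mathrm{Var}_{RL}(L)$ is the minimum of $|N|$ over all right-linear grammars generating $L$, and $\mathrm{RL}_n^V=\{L \text{ regular} : \mathrm{Var}_{RL}(L)\le n\}$. A tree-controlled grammar is a quintuple $G=(N,T,P,S,R)$ where $(N,T,P,S)$ is a context-free grammar whose rules are all non-erasing, except that $S\to\lambda$ is allowed if $S$ does not occur on the right-hand side of any rule, and $R\subseteq (N\cup T)^*$ is a regular control language. The word of level $j$ of a derivation tree is the word of all nodes of depth $j$ read left to right. $L(G)$ consists of all $z\in T^*$ having a derivation tree with yield $z$ such that the words of all levels except the last belong to $R$. For a family $\mathcal F$ of regular languages, $\mathcal{TC}(\mathcal F)$ is the family of languages generated by tree-controlled grammars with control language in $\mathcal F$. $\mathrm{CS}$ is the family of context-sensitive languages. *)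

theory Defs
  imports Main
begin

(* Symbols of a grammar: nonterminals (drawn from the countably infinite supply nat)
   and terminals (drawn from a fixed universe type 't). *)
datatype 't sym = Nt nat | Tm 't

(* A right-linear grammar (N,T,P,S): rules (A, w, Some B) mean A -> wB,
   rules (A, w, None) mean A -> w. *)
type_synonym 'a rlg = "nat set \<times> 'a set \<times> (nat \<times> 'a list \<times> nat option) set \<times> nat"

definition rl_grammar :: "'a rlg \<Rightarrow> bool" where
  "rl_grammar G = (case G of (N, T, P, S) \<Rightarrow>
     finite N \<and> finite T \<and> finite P \<and> S \<in> N \<and>
     (\<forall>(A, w, B) \<in> P. A \<in> N \<and> set w \<subseteq> T \<and> set_option B \<subseteq> N))"

inductive rl_gen :: "'a rlg \<Rightarrow> nat \<Rightarrow> 'a list \<Rightarrow> bool" for G where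
  rl_term: "(A, w, None) \<in> fst (snd (snd G)) \<Longrightarrow> rl_gen G A w"
| rl_step: "(A, u, Some B) \<in> fst (snd (snd G)) \<Longrightarrow> rl_gen G B v \<Longrightarrow> rl_gen G A (u @ v)"

definition rl_lang :: "'a rlg \<Rightarrow> 'a list set" where
  "rl_lang G = {w. rl_gen G (snd (snd (snd G))) w}"

definition regular :: "'a list set \<Rightarrow> bool" where
  "regular L = (\<exists>G. rl_grammar G \<and> rl_lang G = L)"

definition Var_RL :: "'a list set \<Rightarrow> nat" where
  "Var_RL L = (LEAST k. \<exists>G. rl_grammar G \<and> rl_lang G = L \<and> card (fst G) = k)"

definition RL_V :: "nat \<Rightarrow> 'a list set set" where
  "RL_V n = {L. regular L \<and> Var_RL L \<le> n}"

type_synonym 't cfg = "nat set \<times> 't set \<times> (nat \<times> 't sym list) set \<times> nat"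

definition syms_in :: "nat set \<Rightarrow> 't set \<Rightarrow> 't sym list \<Rightarrow> bool" where
  "syms_in N T w = (\<forall>x \<in> set w. case x of Nt A \<Rightarrow> A \<in> N | Tm a \<Rightarrow> a \<in> T)"

definition tc_grammar :: "'t cfg \<Rightarrow> 't sym list set \<Rightarrow> bool" where
  "tc_grammar G R = (case G of (N, T, P, S) \<Rightarrow>
     finite N \<and> finite T \<and> finite P \<and> S \<in> N \<and>
     (\<forall>(A, w) \<in> P. A \<in> N \<and> syms_in N T w) \<and>
     (\<forall>(A, w) \<in> P. w = [] \<longrightarrow> A = S \<and> (\<forall>(B, v) \<in> P. Nt S \<notin> set v)) \<and>
     regular R \<and> (\<forall>w \<in> R. syms_in N T w))"

(* derivation trees; Eps is the lambda-leaf used for the rule S -> lambda *)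
datatype 't dtree = Leaf 't | Eps | Inner nat "'t dtree list"

fun root_word :: "'t dtree \<Rightarrow> 't sym list" where
  "root_word (Leaf a) = [Tm a]"
| "root_word Eps = []"
| "root_word (Inner A ts) = [Nt A]"

fun is_Eps :: "'t dtree \<Rightarrow> bool" where
  "is_Eps Eps = True"
| "is_Eps _ = False"

fun valid_tree :: "'t cfg \<Rightarrow> 't dtree \<Rightarrow> bool" where
  "valid_tree G (Leaf a) = (a \<in> fst (snd G))"
| "valid_tree G Eps = False"
| "valid_tree G (Inner A ts) =
     ((ts = [Eps] \<and> (A, []) \<in> fst (snd (snd G))) \<or>
      (ts \<noteq> [] \<and> (\<forall>t \<in> set ts. valid_tree G t) \<and>
       (A, concat (map root_word ts)) \<in> fst (snd (snd G))))"

fun yield :: "'t dtree \<Rightarrow> 't list" where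
  "yield (Leaf a) = [a]"
| "yield Eps = []"
| "yield (Inner A ts) = concat (map yield ts)"

(* depth of the tree = index of the last level *)
fun height :: "'t dtree \<Rightarrow> nat" where
  "height (Leaf a) = 0"
| "height Eps = 0"
| "height (Inner A ts) = Suc (fold max (map height ts) 0)"

fun level :: "nat \<Rightarrow> 't dtree \<Rightarrow> 't sym list" where
  "level 0 t = root_word t"
| "level (Suc j) (Inner A ts) = concat (map (level j) ts)"
| "level (Suc j) _ = []"

definition tc_lang :: "'t cfg \<Rightarrow> 't sym list set \<Rightarrow> 't list set" where
  "tc_lang G R = {z. \<exists>t. valid_tree G t \<and> (\<exists>ts. t = Inner (snd (snd (snd G))) ts)
                        \<and> yield t = z \<and> (\<forall>j < height t. level j t \<in> R)}"

definition TC :: "'t sym list set set \<Rightarrow> 't list set set" where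
  "TC F = {L. \<exists>G R. tc_grammar G R \<and> R \<in> F \<and> tc_lang G R = L}"

type_synonym 't gram = "nat set \<times> 't set \<times> ('t sym list \<times> 't sym list) set \<times> nat"

definition cs_grammar :: "'t gram \<Rightarrow> bool" where
  "cs_grammar G = (case G of (N, T, P, S) \<Rightarrow>
     finite N \<and> finite T \<and> finite P \<and> S \<in> N \<and>
     (\<forall>(l, r) \<in> P. syms_in N T l \<and> syms_in N T r \<and>
        ((\<exists>x y A w. A \<in> N \<and> w \<noteq> [] \<and> l = x @ [Nt A] @ y \<and> r = x @ w @ y) \<or>
         (l = [Nt S] \<and> r = [] \<and> (\<forall>(l', r') \<in> P. Nt S \<notin> set r')))))"

definition cs_step :: "'t gram \<Rightarrow> 't sym list \<Rightarrow> 't sym list \<Rightarrow> bool" where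
  "cs_step G u v = (\<exists>x y l r. (l, r) \<in> fst (snd (snd G)) \<and> u = x @ l @ y \<and> v = x @ r @ y)"

definition cs_lang :: "'t gram \<Rightarrow> 't list set" where
  "cs_lang G = {z. set z \<subseteq> fst (snd G) \<and>
                   (cs_step G)\<^sup>*\<^sup>* [Nt (snd (snd (snd G)))] (map Tm z)}"

definition CS :: "'t list set set" where
  "CS = {L. \<exists>G. cs_grammar G \<and> cs_lang G = L}"

end

(*
A control language U* with U finite is generated by a right-linear grammar with a single
nonterminal, and such languages already simulate a context-sensitive grammar: to apply the rule
x1...xm -> y1...yn, the symbols x1,...,xm are replaced by markers 1,...,m of this rule in one level
and the markers by y1,...,yn in the next. As U contains the marker symbols only in the complete
block 1...m, no part of a rule can be applied out of context.

Conversely, a context-sensitive grammar can rewrite the levels of a derivation tree sequentially,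
keeping the leaves of earlier levels as frozen letters. A sweep from left to right replaces every
nonterminal by its children while carrying the residual of the control language by the part of the
level that has been read; if the residual reached at the right end contains the empty word, a sweep
from right to left makes the new level ready. A bit that flips with each level keeps the two
sweeps apart, so that at any time only the boundary between swept and ready cells can move.
*)
theory Submission
  imports Defs
begin

section \<open>Residuals of regular languages\<close>

text \<open>A level cuts across all subtrees of a derivation tree, which makes trees awkward in both
  directions. Both inclusions therefore pass through \<open>reach\<close>, a relation on words of
  cells that performs one level per step; trees are left behind once \<open>tc_lang_reach\<close> is
  proved. The sweep has to keep a residual inside a symbol. This is possible because a regular
  language has only finitely many residuals. A further obstacle is that a context-sensitive rule
  cannot see the ends of the word, where the sweeps start and turn. One-symbol rewriting with end
  tests is therefore translated into context-sensitive grammars once and for all, and the sweeps are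
  programmed in that formalism. In the other inclusion the rewriting is parallel: symbols away from
  the rewritten part need rules by which they renew themselves. Letters stay nonterminals until the
  last level, since no control word contains a terminal.\<close>

definition residual :: "'a list set \<Rightarrow> 'a list \<Rightarrow> 'a list set" where
  "residual L u = {v. u @ v \<in> L}"

lemma residual_snoc: "residual L (u @ [x]) = {v. x # v \<in> residual L u}"
  by (simp add: residual_def)

text \<open>A subset construction without automata. The states are the languages of the forms
  \<open>v\<close> followed by an optional nonterminal, where \<open>v\<close> is a suffix of a
  right-hand side. There are finitely many of them, and every residual is the union of the states
  that it contains.\<close>

lemma finite_residuals:
  assumes "regular L"
  shows "finite (range (residual L))"
proof -
  obtain G where G: "rl_grammar G" "rl_lang G = L"
    using assms by (auto simp: regular_def)
  obtain N T P S where G_eq: "G = (N, T, P, S)" by (metis prod_cases4)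
  define tail where
    "tail v k = (case k of None \<Rightarrow> {v} | Some B \<Rightarrow> {v @ z |z. rl_gen G B z})" for v k
  \<comment> \<open>\<open>tail [] (Some S)\<close> is the initial state; proper suffixes occur
    because one rule may emit several letters.\<close>
  define F where "F = insert (tail [] (Some S))
    (\<Union>(A, w, k) \<in> P. (\<lambda>n. tail (drop n w) k) ` {..length w})"
  have fin: "finite F"
    using G(1) unfolding F_def rl_grammar_def G_eq by auto
  have F_I: "tail v k \<in> F" if "(A, x # v, k) \<in> P" for A x v k
  proof -
    have "tail v k \<in> (\<lambda>n. tail (drop n (x # v)) k) ` {..length (x # v)}"
      by (rule image_eqI[of _ _ 1]) auto
    then show ?thesis using that unfolding F_def by blast
  qed
  \<comment> \<open>Rules \<open>A \<rightarrow> B\<close> with empty word emit nothing, so the rule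
    that emits \<open>x\<close> may belong to another nonterminal than \<open>A\<close>.\<close>
  have gen: "\<exists>B v k. (B, x # v, k) \<in> P \<and> z \<in> tail v k \<and> (\<forall>z'\<in>tail v k. rl_gen G A (x # z'))"
    if "rl_gen G A (x # z)" for A x z
    using that
  proof (induction A "x # z" arbitrary: z rule: rl_gen.induct)
    case (rl_term A)
    moreover have "rl_gen G A (x # z)" using rl_term by (rule rl_gen.rl_term)
    ultimately have "(A, x # z, None) \<in> P" "z \<in> tail z None" "\<forall>z'\<in>tail z None. rl_gen G A (x # z')"
      by (auto simp: tail_def G_eq)
    then show ?case by blast
  next
    case (rl_step A u B v)
    show ?case
    proof (cases u)
      case Nil
      then have "v = x # z" using rl_step by simp
      then obtain C w k where "(C, x # w, k) \<in> P" "z \<in> tail w k" "\<forall>z'\<in>tail w k. rl_gen G B (x # z')"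
        using rl_step(3) by blast
      moreover have "rl_gen G A (x # z')" if "rl_gen G B (x # z')" for z'
        using rl_gen.rl_step[OF rl_step(1) that] Nil by simp
      ultimately show ?thesis by blast
    next
      case (Cons y u')
      then have y: "y = x" "z = u' @ v" using rl_step(4) by auto
      have "(A, x # u', Some B) \<in> P" using rl_step(1) Cons y by (simp add: G_eq)
      moreover have "z \<in> tail u' (Some B)" using rl_step(2) y by (auto simp: tail_def)
      moreover have "rl_gen G A (x # z')" if z': "z' \<in> tail u' (Some B)" for z'
      proof -
        obtain v' where "z' = u' @ v'" "rl_gen G B v'" using z' by (auto simp: tail_def)
        moreover have "rl_gen G A (u @ v')"
          using rl_step(1) \<open>rl_gen G B v'\<close> by (rule rl_gen.rl_step)
        ultimately show ?thesis using Cons y(1) by simp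
      qed
      ultimately show ?thesis by blast
    qed
  qed
  \<comment> \<open>The derivative of a state by \<open>x\<close> is covered by states that it
    contains.\<close>
  have step: "\<exists>g\<in>F. z \<in> g \<and> (\<forall>z'\<in>g. x # z' \<in> f)" if "f \<in> F" and xz: "x # z \<in> f" for f x z
  proof -
    have "\<exists>v k. f = tail v k \<and> (v = [] \<or> (\<exists>A w n. (A, w, k) \<in> P \<and> v = drop n w))"
    proof (cases "f = tail [] (Some S)")
      case False
      then obtain A w k n where "(A, w, k) \<in> P" "f = tail (drop n w) k"
        using \<open>f \<in> F\<close> unfolding F_def by auto
      then show ?thesis by blast
    qed blast
    then obtain v k where f: "f = tail v k" and v: "v = [] \<or> (\<exists>A w n. (A, w, k) \<in> P \<and> v = drop n w)"
      by blast
    show ?thesis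
    proof (cases v)
      case Nil
      then obtain B where "k = Some B" "rl_gen G B (x # z)"
        using xz unfolding f Nil tail_def by (cases k) auto
      then obtain C w k' where "(C, x # w, k') \<in> P" "z \<in> tail w k'" "\<forall>z'\<in>tail w k'. rl_gen G B (x # z')"
        using gen by blast
      moreover have "x # z' \<in> f" if "rl_gen G B (x # z')" for z'
        using that unfolding f Nil tail_def \<open>k = Some B\<close> by simp
      ultimately show ?thesis using F_I[of C x w k'] by (intro bexI[of _ "tail w k'"]) auto
    next
      case (Cons y v')
      then obtain A w n where w: "(A, w, k) \<in> P" "v = drop n w" using v by auto
      have "n < length w" using Cons w(2) by (cases "n < length w") auto
      then have "v' = drop (Suc n) w"
        using Cons w(2) by (metis list.sel(3) tl_drop drop_Suc)
      then have "tail v' k \<in> F"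
        unfolding F_def using w(1) \<open>n < length w\<close> by (intro insertI2 UN_I[of "(A, w, k)"]) auto
      moreover have "z \<in> tail v' k" "\<forall>z'\<in>tail v' k. x # z' \<in> f"
        using xz unfolding f Cons tail_def by (cases k; auto)+
      ultimately show ?thesis by blast
    qed
  qed
  have "residual L u \<in> Union ` Pow F" for u
  proof -
    have "\<exists>g\<in>F. z \<in> g \<and> g \<subseteq> residual L u" if "z \<in> residual L u" for z
      using that
    proof (induction u arbitrary: z rule: rev_induct)
      case Nil
      have "residual L [] = tail [] (Some S)"
        using G(2) by (simp add: residual_def tail_def rl_lang_def G_eq)
      then show ?case using Nil unfolding F_def by (intro bexI[of _ "tail [] (Some S)"]) simp_all
    next
      case (snoc x u)
      then have "x # z \<in> residual L u" by (simp add: residual_snoc)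
      then obtain f where f: "f \<in> F" "x # z \<in> f" "f \<subseteq> residual L u"
        using snoc.IH by blast
      obtain g where "g \<in> F" "z \<in> g" "\<forall>z'\<in>g. x # z' \<in> f"
        using step[OF f(1,2)] by blast
      then show ?case using f(3) unfolding residual_snoc by (intro bexI[of _ g]) auto
    qed
    then have "residual L u = \<Union>{g \<in> F. g \<subseteq> residual L u}" by auto
    then show ?thesis by (rule image_eqI) simp
  qed
  then have "range (residual L) \<subseteq> Union ` Pow F" by blast
  then show ?thesis by (rule finite_subset) (simp add: fin)
qed

text \<open>A single nonterminal emits a word of \<open>U\<close> and returns to itself, or stops
  with the empty word.\<close>

lemma star_in_RL_V:
  fixes U :: "'a list set"
  assumes "finite U" "1 \<le> n"
  shows "concat ` lists U \<in> RL_V n"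
proof -
  define G :: "'a rlg" where
    "G = ({0 :: nat}, \<Union> (set ` U), insert (0, [], None) ((\<lambda>u. (0, u, Some 0)) ` U), 0 :: nat)"
  have G: "rl_grammar G"
    using assms(1) unfolding rl_grammar_def G_def by auto
  have "rl_gen G A w \<Longrightarrow> w \<in> concat ` lists U" for A w
  proof (induction rule: rl_gen.induct)
    case (rl_term A w)
    then show ?case by (auto simp: G_def intro: image_eqI[of _ _ "[]"])
  next
    case (rl_step A u B v)
    then obtain us where "v = concat us" "us \<in> lists U" "u \<in> U" by (auto simp: G_def)
    then show ?case by (intro image_eqI[of _ _ "u # us"]) auto
  qed
  moreover have "rl_gen G 0 (concat us)" if "us \<in> lists U" for us
    using that
  proof (induction us)
    case Nil
    then show ?case by (auto simp: G_def intro: rl_gen.rl_term)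
  next
    case (Cons u us)
    then have "rl_gen G 0 (u @ concat us)"
      by (intro rl_gen.rl_step[of _ _ 0]) (auto simp: G_def)
    then show ?case by simp
  qed
  ultimately have L: "rl_lang G = concat ` lists U"
    by (auto simp: rl_lang_def G_def)
  have "Var_RL (concat ` lists U) \<le> 1"
    unfolding Var_RL_def
  proof (rule Least_le)
    show "\<exists>G. rl_grammar G \<and> rl_lang G = concat ` lists U \<and> card (fst G) = 1"
      using G L by (intro exI[of _ G]) (auto simp: G_def)
  qed
  then show ?thesis using G L assms(2) unfolding RL_V_def regular_def by fastforce
qed


section \<open>Derivation trees as parallel rewriting\<close>

(* Old letters are leaves of earlier levels: they belong to the yield, but not to the level word.
   The rule S -> [] cannot occur in a derivation of another word and is treated separately. *)
datatype 't cell = Act "'t sym" | Old 't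

inductive expand :: "(nat \<times> 't sym list) set \<Rightarrow> 't cell \<Rightarrow> 't cell list \<Rightarrow> bool" for P where
  expand_Nt: "(A, w) \<in> P \<Longrightarrow> w \<noteq> [] \<Longrightarrow> expand P (Act (Nt A)) (map Act w)"
| expand_Tm: "expand P (Act (Tm a)) [Old a]"
| expand_Old: "expand P (Old a) [Old a]"

inductive_cases expand_NtE: "expand P (Act (Nt A)) w"

definition par :: "(nat \<times> 't sym list) set \<Rightarrow> 't cell list \<Rightarrow> 't cell list \<Rightarrow> bool" where
  "par P c d = (\<exists>ws. list_all2 (expand P) c ws \<and> d = concat ws)"

fun visible :: "'t cell \<Rightarrow> 't sym list" where
  "visible (Act x) = [x]"
| "visible (Old a) = []"

definition level_word :: "'t cell list \<Rightarrow> 't sym list" where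
  "level_word c = concat (map visible c)"

definition spells :: "'t cell list \<Rightarrow> 't list \<Rightarrow> bool" where
  "spells = list_all2 (\<lambda>x a. x = Act (Tm a) \<or> x = Old a)"

text \<open>The control language is consulted only when a word is rewritten. The word reached last
  is thus unconstrained, like the last level of a tree.\<close>

inductive reach :: "(nat \<times> 't sym list) set \<Rightarrow> 't sym list set \<Rightarrow> nat \<Rightarrow> 't cell list \<Rightarrow> bool"
  for P R S where
  reach_start: "reach P R S [Act (Nt S)]"
| reach_par: "reach P R S c \<Longrightarrow> level_word c \<in> R \<Longrightarrow> par P c d \<Longrightarrow> reach P R S d"

lemma level_word_append [simp]: "level_word (c @ d) = level_word c @ level_word d"
  by (simp add: level_word_def)

lemma level_word_Nil [simp]: "level_word [] = []"
  by (simp add: level_word_def)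

lemma level_word_Cons [simp]: "level_word (x # c) = visible x @ level_word c"
  by (simp add: level_word_def)

lemma level_word_Act [simp]: "level_word (map Act w) = w"
  by (induction w) auto

lemma expand_nonempty: "expand P x w \<Longrightarrow> w \<noteq> []"
  by (erule expand.cases) auto

lemma par_Nil [simp]: "par P [] d \<longleftrightarrow> d = []"
  by (auto simp: par_def)

lemma par_single: "par P [x] w \<longleftrightarrow> expand P x w"
  by (auto simp: par_def list_all2_Cons1)

lemma par_append: "par P c d \<Longrightarrow> par P c' d' \<Longrightarrow> par P (c @ c') (d @ d')"
  unfolding par_def by (metis concat_append list_all2_appendI)

lemma par_append1: "par P (c @ c') e \<Longrightarrow> \<exists>d d'. e = d @ d' \<and> par P c d \<and> par P c' d'"
  unfolding par_def by (metis concat_append list_all2_append1)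

lemma par_Cons: "par P (x # c) e \<longleftrightarrow> (\<exists>w d. e = w @ d \<and> expand P x w \<and> par P c d)"
  using par_append1[of P "[x]" c e] par_append[of P "[x]"] by (auto simp: par_single)

lemma par_concat:
  "(\<And>t. t \<in> set ts \<Longrightarrow> par P (f t) (g t)) \<Longrightarrow> par P (concat (map f ts)) (concat (map g ts))"
  by (induction ts) (auto intro: par_append)

lemma par_nonempty: "par P c d \<Longrightarrow> c \<noteq> [] \<Longrightarrow> d \<noteq> []"
  by (cases c) (auto simp: par_Cons dest: expand_nonempty)

lemma reach_nonempty: "reach P R S c \<Longrightarrow> c \<noteq> []"
  by (induction rule: reach.induct) (auto dest: par_nonempty)

lemma spells_Nil [simp]: "spells [] []"
  by (simp add: spells_def)

lemma spells_append: "spells c z \<Longrightarrow> spells c' z' \<Longrightarrow> spells (c @ c') (z @ z')"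
  unfolding spells_def by (rule list_all2_appendI)

section \<open>From derivation trees to reachable words of cells\<close>

lemma fold_max_le: "fold max xs (m :: nat) \<le> k \<longleftrightarrow> m \<le> k \<and> (\<forall>x\<in>set xs. x \<le> k)"
  by (induction xs arbitrary: m) auto

text \<open>The frontier of the tree truncated at depth \<open>j\<close>: nodes of depth
  \<open>j\<close> are active, leaves of smaller depth stay in place as \<open>Old\<close>.\<close>

fun cut :: "nat \<Rightarrow> 't dtree \<Rightarrow> 't cell list" where
  "cut 0 t = map Act (root_word t)"
| "cut (Suc j) (Inner A ts) = concat (map (cut j) ts)"
| "cut (Suc j) (Leaf a) = [Old a]"
| "cut (Suc j) Eps = []"

lemma level_word_concat: "level_word (concat cs) = concat (map level_word cs)"
  by (induction cs) auto

lemma level_word_cut: "level_word (cut j t) = level j t"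
proof (induction j t rule: cut.induct)
  case (2 j A ts)
  then show ?case by (auto simp: level_word_concat intro!: arg_cong[of _ _ concat])
qed auto

lemma concat_cut_0: "concat (map (cut 0) ts) = map Act (concat (map root_word ts))"
  by (induction ts) auto

fun lambda_free :: "'t dtree \<Rightarrow> bool" where
  "lambda_free (Leaf a) = True"
| "lambda_free Eps = False"
| "lambda_free (Inner A ts) = (\<forall>t\<in>set ts. lambda_free t)"

lemma valid_tree_root_word: "valid_tree G t \<Longrightarrow> root_word t \<noteq> []"
  by (cases t) auto

text \<open>An erasing rule has left side \<open>S\<close>, and its presence bans \<open>S\<close>
  from all right-hand sides. An erasing node can therefore have no parent and is the whole
  tree.\<close>

lemma valid_tree_lambda_free:
  assumes "tc_grammar (N, T, P, S) R" "valid_tree (N, T, P, S) t" "t \<noteq> Inner S [Eps]"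
  shows "lambda_free t"
  using assms(2,3)
proof (induction t)
  case (Inner A ts)
  have erase: "A = S \<and> Nt S \<notin> set v" if "(A, []) \<in> P" "(B, v) \<in> P" for A B v
    using assms(1) that unfolding tc_grammar_def by fast
  have "ts \<noteq> [Eps]"
    using Inner.prems erase by auto
  then have ts: "\<forall>t\<in>set ts. valid_tree (N, T, P, S) t" "(A, concat (map root_word ts)) \<in> P"
    using Inner.prems by auto
  have "t \<noteq> Inner S [Eps]" if "t \<in> set ts" for t
  proof
    assume t: "t = Inner S [Eps]"
    then have "(S, []) \<in> P" using ts(1) that by fastforce
    then have "Nt S \<notin> set (concat (map root_word ts))" using erase ts(2) by blast
    then show False using that t by force
  qed
  then show ?case using Inner.IH ts(1) by auto
qed auto

text \<open>Moving the cut one level down replaces the frontier nodes by their children, while a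
  leaf that is passed freezes.\<close>

lemma par_cut:
  "valid_tree (N, T, P, S) t \<Longrightarrow> lambda_free t \<Longrightarrow> par P (cut j t) (cut (Suc j) t)"
proof (induction t arbitrary: j)
  case (Leaf a)
  then show ?case by (cases j) (auto simp: par_single intro: expand.intros)
next
  case (Inner A ts)
  then have ts: "ts \<noteq> []" "\<forall>t\<in>set ts. valid_tree (N, T, P, S) t"
    "(A, concat (map root_word ts)) \<in> P" by auto
  show ?case
  proof (cases j)
    case 0
    have "concat (map root_word ts) \<noteq> []"
      using ts(1,2) valid_tree_root_word by (cases ts) fastforce+
    then have "expand P (Act (Nt A)) (map Act (concat (map root_word ts)))"
      using ts(3) by (rule expand_Nt[rotated])
    moreover have "cut 1 (Inner A ts) = map Act (concat (map root_word ts))"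
      by (simp add: concat_cut_0)
    ultimately show ?thesis using 0 by (simp add: par_single)
  next
    case (Suc k)
    have "par P (concat (map (cut k) ts)) (concat (map (cut (Suc k)) ts))"
      using Inner ts(2) by (intro par_concat) auto
    then show ?thesis using Suc by simp
  qed
qed auto

lemma spells_cut:
  "valid_tree G t \<Longrightarrow> lambda_free t \<Longrightarrow> height t \<le> j \<Longrightarrow> spells (cut j t) (yield t)"
proof (induction t arbitrary: j)
  case (Leaf a)
  then show ?case by (cases j) (auto simp: spells_def)
next
  case (Inner A ts)
  then obtain k where k: "j = Suc k" "\<forall>t\<in>set ts. height t \<le> k"
    by (cases j) (auto simp: fold_max_le)
  then have "\<forall>t\<in>set ts. spells (cut k t) (yield t)" using Inner by auto
  then have "spells (concat (map (cut k) ts)) (concat (map yield ts))"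
    by (induction ts) (auto intro: spells_append)
  then show ?case using k by simp
qed auto

lemma reach_cut:
  assumes "valid_tree (N, T, P, S) (Inner S ts)" "lambda_free (Inner S ts)"
    "\<forall>j < h. level j (Inner S ts) \<in> R"
  shows "reach P R S (cut h (Inner S ts))"
  using assms(3)
proof (induction h)
  case 0
  then show ?case by (simp add: reach_start)
next
  case (Suc h)
  then show ?case
    using par_cut[OF assms(1,2)] by (metis level_word_cut less_Suc_eq reach_par)
qed

section \<open>From reachable words of cells back to derivation trees\<close>

definition cells :: "nat set \<Rightarrow> 't set \<Rightarrow> 't cell set" where
  "cells N T = Act ` (Nt ` N \<union> Tm ` T) \<union> Old ` T"

lemma syms_in_iff: "syms_in N T w \<longleftrightarrow> set w \<subseteq> Nt ` N \<union> Tm ` T"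
proof -
  have "(case x of Nt A \<Rightarrow> A \<in> N | Tm a \<Rightarrow> a \<in> T) \<longleftrightarrow> x \<in> Nt ` N \<union> Tm ` T" for x
    by (cases x) auto
  then show ?thesis by (auto simp: syms_in_def)
qed

lemma par_cells:
  assumes "\<forall>(A, w) \<in> P. syms_in N T w" "par P c d" "set c \<subseteq> cells N T"
  shows "set d \<subseteq> cells N T"
  using assms(2,3)
proof (induction c arbitrary: d)
  case (Cons x c)
  then obtain w d' where d: "d = w @ d'" "expand P x w" "par P c d'" by (auto simp: par_Cons)
  from d(2) have "set w \<subseteq> cells N T"
  proof cases
    case (expand_Nt A v)
    then have "set v \<subseteq> Nt ` N \<union> Tm ` T" using assms(1) by (auto simp: syms_in_iff)
    then show ?thesis using expand_Nt by (auto simp: cells_def)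
  qed (use Cons.prems(2) in \<open>auto simp: cells_def\<close>)
  then show ?case using d Cons by auto
qed auto

lemma reach_cells:
  assumes "\<forall>(A, w) \<in> P. syms_in N T w" "S \<in> N" "reach P R S c"
  shows "set c \<subseteq> cells N T"
  using assms(3)
proof (induction rule: reach.induct)
  case reach_start
  then show ?case using assms(2) by (auto simp: cells_def)
next
  case (reach_par c d)
  then show ?case using par_cells[OF assms(1)] by blast
qed

text \<open>One tree for each cell of a word. An \<open>Old\<close> letter carries its leaf only for
  the sake of the yield: the level of that leaf was counted while the letter was active, so
  \<open>forest_level\<close> omits it.\<close>

definition forest :: "'t cfg \<Rightarrow> nat \<Rightarrow> ('t cell \<times> 't dtree) list \<Rightarrow> bool" where
  "forest G h p = (\<forall>(x, t) \<in> set p. case x of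
     Act y \<Rightarrow> root_word t = [y] \<and> valid_tree G t \<and> height t \<le> h
   | Old a \<Rightarrow> t = Leaf a)"

definition forest_level :: "nat \<Rightarrow> ('t cell \<times> 't dtree) list \<Rightarrow> 't sym list" where
  "forest_level j p = concat (map (\<lambda>(x, t). case x of Act y \<Rightarrow> level j t | Old a \<Rightarrow> []) p)"

definition forest_yield :: "('t cell \<times> 't dtree) list \<Rightarrow> 't list" where
  "forest_yield p = concat (map (\<lambda>(x, t). yield t) p)"

lemma forest_Acts:
  assumes "forest G h p" "map fst p = map Act w"
  shows "concat (map root_word (map snd p)) = w"
    and "\<forall>t\<in>set (map snd p). valid_tree G t \<and> height t \<le> h"
    and "concat (map (level j) (map snd p)) = forest_level j p"
    and "concat (map yield (map snd p)) = forest_yield p"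
proof -
  have "concat (map root_word (map snd p)) = w \<and> (\<forall>t\<in>set (map snd p). valid_tree G t \<and> height t \<le> h)
    \<and> concat (map (level j) (map snd p)) = forest_level j p
    \<and> concat (map yield (map snd p)) = forest_yield p"
    using assms
  proof (induction p arbitrary: w)
    case (Cons q p)
    obtain x t where q: "q = (x, t)" by (cases q)
    obtain y v where w: "w = y # v" "x = Act y" "map fst p = map Act v"
      using Cons.prems(2) q by (cases w) auto
    have "forest G h p" "root_word t = [y]" "valid_tree G t" "height t \<le> h"
      using Cons.prems(1) q w(2) by (auto simp: forest_def)
    then show ?case
      using Cons.IH[OF _ w(3)] q w by (simp add: forest_level_def forest_yield_def)
  qed (auto simp: forest_level_def forest_yield_def)
  then show "concat (map root_word (map snd p)) = w"
    "\<forall>t\<in>set (map snd p). valid_tree G t \<and> height t \<le> h"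
    "concat (map (level j) (map snd p)) = forest_level j p"
    "concat (map yield (map snd p)) = forest_yield p" by simp_all
qed

lemma forest_level_0: "forest G h p \<Longrightarrow> forest_level 0 p = level_word (map fst p)"
  by (induction p) (auto simp: forest_def forest_level_def level_word_def split: cell.splits)

lemma forest_append: "forest G h (p @ q) \<longleftrightarrow> forest G h p \<and> forest G h q"
  by (auto simp: forest_def)

text \<open>A step of \<open>par\<close> read backwards: the trees over the cells that a nonterminal
  produced become the children of a new node, so that all levels shift by one. The condition on
  \<open>T\<close> makes the leaf of an active letter valid.\<close>

lemma forest_par:
  assumes "par P c d" "\<forall>a. Act (Tm a) \<in> set c \<longrightarrow> a \<in> T"
    "forest (N, T, P, S) h p" "map fst p = d"
  shows "\<exists>q. forest (N, T, P, S) (Suc h) q \<and> map fst q = c \<and>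
    (\<forall>j. forest_level (Suc j) q = forest_level j p) \<and> forest_yield q = forest_yield p"
  using assms
proof (induction c arbitrary: d p)
  case Nil
  then show ?case by (auto simp: forest_def forest_level_def)
next
  case (Cons x c)
  obtain w d' where d: "d = w @ d'" "expand P x w" "par P c d'"
    using Cons.prems(1) by (auto simp: par_Cons)
  then obtain p1 p2 where p: "p = p1 @ p2" "map fst p1 = w" "map fst p2 = d'"
    using Cons.prems(4) by (auto simp: map_eq_append_conv)
  obtain q where q: "forest (N, T, P, S) (Suc h) q" "map fst q = c"
    "\<And>j. forest_level (Suc j) q = forest_level j p2" "forest_yield q = forest_yield p2"
    using Cons.IH[OF d(3) _ _ p(3)] Cons.prems(2,3) unfolding p(1) forest_append by auto
  have p1: "forest (N, T, P, S) h p1" using Cons.prems(3) unfolding p(1) forest_append by simp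
  have "\<exists>t. forest (N, T, P, S) (Suc h) [(x, t)] \<and>
    (\<forall>j. forest_level (Suc j) [(x, t)] = forest_level j p1) \<and> forest_yield [(x, t)] = forest_yield p1"
    using d(2)
  proof cases
    case (expand_Nt A v)
    then have "map fst p1 = map Act v" using p(2) by simp
    note f = forest_Acts[OF p1 this]
    have "map snd p1 \<noteq> []" using expand_Nt p(2) by auto
    then show ?thesis using expand_Nt f
      by (intro exI[of _ "Inner A (map snd p1)"])
        (auto simp: forest_def forest_level_def[of _ "[_]"] forest_yield_def[of "[_]"] fold_max_le
          simp del: map_map)
  next
    case (expand_Tm a)
    then show ?thesis using p(2) p1 Cons.prems(2)
      by (intro exI[of _ "Leaf a"]) (auto simp: forest_def forest_level_def forest_yield_def)
  next
    case (expand_Old a)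
    then show ?thesis using p(2) p1
      by (intro exI[of _ "Leaf a"]) (auto simp: forest_def forest_level_def forest_yield_def)
  qed
  then obtain t where "forest (N, T, P, S) (Suc h) [(x, t)]"
    "\<And>j. forest_level (Suc j) [(x, t)] = forest_level j p1" "forest_yield [(x, t)] = forest_yield p1"
    by blast
  then show ?case using q p(1)
    by (intro exI[of _ "(x, t) # q"]) (auto simp: forest_def forest_level_def forest_yield_def)
qed

text \<open>\<open>reach\<close> adds its steps at the end, whereas a tree grows at its root. The
  induction strips the last step and so needs an arbitrary forest over the word. The number
  \<open>h\<close> bounds the heights and the levels known to obey the control language.\<close>

lemma reach_forest:
  assumes "\<forall>(A, w) \<in> P. syms_in N T w" "S \<in> N" "reach P R S c"
    "forest (N, T, P, S) h p" "map fst p = c" "\<forall>j < h. forest_level j p \<in> R"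
  shows "\<exists>h q. forest (N, T, P, S) h q \<and> map fst q = [Act (Nt S)] \<and>
    (\<forall>j < h. forest_level j q \<in> R) \<and> forest_yield q = forest_yield p"
  using assms(3-)
proof (induction arbitrary: h p rule: reach.induct)
  case reach_start
  then show ?case by (intro exI[of _ h] exI[of _ p]) simp
next
  case (reach_par c d)
  have T: "\<forall>a. Act (Tm a) \<in> set c \<longrightarrow> a \<in> T"
    using reach_cells[OF assms(1,2) reach_par(1)] by (auto simp: cells_def)
  obtain q where q: "forest (N, T, P, S) (Suc h) q" "map fst q = c"
    "\<And>j. forest_level (Suc j) q = forest_level j p" "forest_yield q = forest_yield p"
    using forest_par[OF reach_par(3) T reach_par.prems(1,2)] by auto
  have "forest_level j q \<in> R" if "j < Suc h" for j
    using that reach_par(2) reach_par.prems(3) q(2,3) forest_level_0[OF q(1)] by (cases j) auto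
  then show ?case using reach_par.IH[OF q(1,2)] q(4) by simp
qed

text \<open>The part \<open>?E\<close> accounts for the tree \<open>Inner S [Eps]\<close>, the one
  that \<open>valid_tree_lambda_free\<close> leaves out.\<close>

lemma tc_lang_reach:
  assumes G: "tc_grammar (N, T, P, S) R"
  shows "tc_lang (N, T, P, S) R =
    {z. \<exists>c. reach P R S c \<and> spells c z} \<union> (if (S, []) \<in> P \<and> [Nt S] \<in> R then {[]} else {})"
    (is "?L = ?A \<union> ?E")
proof (intro equalityI subsetI)
  fix z assume "z \<in> ?L"
  then obtain ts where t: "valid_tree (N, T, P, S) (Inner S ts)" "yield (Inner S ts) = z"
    "\<forall>j < height (Inner S ts). level j (Inner S ts) \<in> R"
    by (auto simp: tc_lang_def simp del: yield.simps height.simps valid_tree.simps)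
  show "z \<in> ?A \<union> ?E"
  proof (cases "ts = [Eps]")
    case True
    then show ?thesis using t by auto
  next
    case False
    then have "lambda_free (Inner S ts)" using valid_tree_lambda_free[OF G t(1)] by blast
    then show ?thesis using reach_cut[OF t(1) _ t(3)] spells_cut[OF t(1)] t(2) by blast
  qed
next
  fix z assume "z \<in> ?A \<union> ?E"
  then consider c where "reach P R S c" "spells c z" | "(S, []) \<in> P" "[Nt S] \<in> R" "z = []"
    by (auto split: if_splits)
  then show "z \<in> ?L"
  proof cases
    case 1
    have P: "\<forall>(A, w) \<in> P. syms_in N T w" "S \<in> N"
      using G by (auto simp: tc_grammar_def)
    \<comment> \<open>Over the final word all trees are leaves; with height bound 0 the condition on
      the levels is vacuous.\<close>
    define p where "p = zip c (map Leaf z)"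
    have "set c \<subseteq> cells N T" by (rule reach_cells[OF P 1(1)])
    with 1(2) have "forest (N, T, P, S) 0 p \<and> map fst p = c \<and> forest_yield p = z"
      unfolding spells_def p_def
      by (induction rule: list_all2_induct) (auto simp: forest_def forest_yield_def cells_def)
    then obtain h q where q: "forest (N, T, P, S) h q" "map fst q = [Act (Nt S)]"
      "\<forall>j < h. forest_level j q \<in> R" "forest_yield q = z"
      using reach_forest[OF P 1(1), of 0 p] by auto
    then obtain t where "q = [(Act (Nt S), t)]" by auto
    then have t: "root_word t = [Nt S]" "valid_tree (N, T, P, S) t" "height t \<le> h"
      "\<forall>j < h. level j t \<in> R" "yield t = z"
      using q by (auto simp: forest_def forest_level_def forest_yield_def)
    then show ?thesis
      by (cases t) (auto simp: tc_lang_def simp del: yield.simps height.simps valid_tree.simps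
          intro!: exI[of _ t])
  next
    case 2
    then show ?thesis
      by (auto simp: tc_lang_def intro!: exI[of _ "Inner S [Eps]"])
  qed
qed

section \<open>Context-sensitive grammars as tree-controlled grammars\<close>

(* Mark l r i is the marker of the i-th symbol of l in an application of the rule (l, r). *)
datatype 't csym = Start | Orig "'t sym" | Mark "'t sym list" "'t sym list" nat

text \<open>Nonterminals are natural numbers, so structured symbols have to be coded; finiteness of
  the alphabet in use supplies the code.\<close>

lemma finite_injection: "finite A \<Longrightarrow> \<exists>e :: 'a \<Rightarrow> nat. inj_on e A"
  using finite_imp_inj_to_nat_seg by blast

lemma cs_step_rule: "(l, r) \<in> P \<Longrightarrow> cs_step (N, T, P, S) l r"
  unfolding cs_step_def by (intro exI[of _ "[]"] exI[of _ l] exI[of _ r]) simp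

lemma cs_step_context: "cs_step G u v \<Longrightarrow> cs_step G (x @ u @ y) (x @ v @ y)"
  unfolding cs_step_def by (metis append.assoc)

lemma cs_steps_append:
  assumes "(cs_step G)\<^sup>*\<^sup>* u u'" "(cs_step G)\<^sup>*\<^sup>* v v'"
  shows "(cs_step G)\<^sup>*\<^sup>* (u @ v) (u' @ v')"
proof -
  have "(cs_step G)\<^sup>*\<^sup>* (u @ v) (u' @ v)"
    using assms(1)
  proof (induction rule: rtranclp_induct)
    case (step y z)
    then show ?case using cs_step_context[of G y z "[]" v] by (simp add: rtranclp.rtrancl_into_rtrancl)
  qed simp
  moreover have "(cs_step G)\<^sup>*\<^sup>* (u' @ v) (u' @ v')"
    using assms(2)
  proof (induction rule: rtranclp_induct)
    case (step y z)
    then show ?case using cs_step_context[of G y z u' "[]"] by (simp add: rtranclp.rtrancl_into_rtrancl)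
  qed simp
  ultimately show ?thesis by (rule rtranclp_trans)
qed

lemma pieces_eq:
  assumes "0 < m" "m \<le> length r"
  shows "concat (map (\<lambda>i. if Suc i < m then [r ! i] else drop i r) [0..<m]) = r"
proof -
  obtain k where k: "m = Suc k" using assms(1) by (cases m) auto
  have "map (\<lambda>i. if Suc i < m then [r ! i] else drop i r) [0..<k] = map (\<lambda>i. [r ! i]) [0..<k]"
    by (simp add: k)
  then have "concat (map (\<lambda>i. if Suc i < m then [r ! i] else drop i r) [0..<k]) = map ((!) r) [0..<k]"
    by (simp only: concat_map_singleton)
  also have "\<dots> = take k r" using assms(2) k by (intro nth_equalityI) auto
  finally show ?thesis by (simp add: k)
qed

text \<open>The alphabet \<open>\<Sigma>\<close> is fixed by \<open>defines\<close> since the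
  assumption that \<open>e\<close> is injective refers to it. \<open>Q\<close> omits the erasing
  rule, which is taken over by \<open>Start\<close>.\<close>

locale cs_as_tc =
  fixes N :: "nat set" and T :: "'t set" and P S and e :: "'t csym \<Rightarrow> nat"
    and V \<Sigma> Q
  defines "V \<equiv> Nt ` N \<union> Tm ` T"
    and "Q \<equiv> P - UNIV \<times> {[]}"
    and "\<Sigma> \<equiv> {Start} \<union> Orig ` V \<union> (\<Union>(l, r) \<in> Q. Mark l r ` {..<length l})"
  assumes G: "cs_grammar (N, T, P, S)"
    and inj: "inj_on e \<Sigma>"
begin

abbreviation n :: "'t csym \<Rightarrow> 't sym" where "n x \<equiv> Nt (e x)"

text \<open>How the markers share \<open>r\<close>: one symbol each, and the surplus for the last
  marker. As \<open>r\<close> is at least as long as \<open>l\<close>, no marker is erased.\<close>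

definition piece :: "'t sym list \<Rightarrow> 't sym list \<Rightarrow> nat \<Rightarrow> 't sym list" where
  "piece l r i = (if Suc i < length l then [r ! i] else drop i r)"

definition block :: "'t sym list \<Rightarrow> 't sym list \<Rightarrow> 't sym list" where
  "block l r = map (\<lambda>i. n (Mark l r i)) [0..<length l]"

text \<open>\<open>Start\<close> is fresh and hence may have an erasing rule. \<open>Orig x\<close>
  can renew itself because every nonterminal node of a tree has children, even where the simulated
  word does not change.\<close>

definition rules :: "(nat \<times> 't sym list) set" where
  "rules = {(e Start, [n (Orig (Nt S))])} \<union> (if ([Nt S], []) \<in> P then {(e Start, [])} else {})
    \<union> (\<lambda>x. (e (Orig x), [n (Orig x)])) ` V
    \<union> (\<lambda>a. (e (Orig (Tm a)), [Tm a])) ` T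
    \<union> (\<Union>(l, r) \<in> Q. \<Union>i \<in> {..<length l}.
        {(e (Orig (l ! i)), [n (Mark l r i)]),
         (e (Mark l r i), map (\<lambda>x. n (Orig x)) (piece l r i))})"

text \<open>Only nonterminals occur in these words, so a terminal can appear on no level but the
  last.\<close>

definition U :: "'t sym list set" where
  "U = {[n Start]} \<union> (\<lambda>x. [n (Orig x)]) ` V \<union> (\<lambda>(l, r). block l r) ` Q"

definition control :: "'t sym list set" where
  "control = concat ` lists U"

lemma finite_N: "finite N" and finite_T: "finite T" and finite_P: "finite P" and S_in: "S \<in> N"
  using G by (auto simp: cs_grammar_def)

lemma finite_V: "finite V" unfolding V_def using finite_N finite_T by simp

lemma finite_Q: "finite Q"
  unfolding Q_def using finite_P by simp

lemma Q_props:
  assumes "(l, r) \<in> Q"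
  shows "l \<noteq> []" "length l \<le> length r" "set l \<subseteq> V" "set r \<subseteq> V"
proof -
  have "(l, r) \<in> P" "r \<noteq> []" using assms by (auto simp: Q_def)
  then have "syms_in N T l \<and> syms_in N T r \<and> (\<exists>x y A w. w \<noteq> [] \<and> l = x @ [Nt A] @ y \<and> r = x @ w @ y)"
    using G unfolding cs_grammar_def by fast
  then obtain x y A w where "syms_in N T l" "syms_in N T r" "w \<noteq> []" "l = x @ [Nt A] @ y" "r = x @ w @ y"
    by blast
  then show "l \<noteq> []" "length l \<le> length r" "set l \<subseteq> V" "set r \<subseteq> V"
    by (auto simp: syms_in_iff V_def Suc_le_eq)
qed

lemma erasing_rule:
  assumes "(l, []) \<in> P"
  shows "l = [Nt S]" "(l', r') \<in> P \<Longrightarrow> Nt S \<notin> set r'"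
proof -
  have "l = [Nt S] \<and> (\<forall>(l', r') \<in> P. Nt S \<notin> set r')"
    using G assms unfolding cs_grammar_def by force
  then show "l = [Nt S]" "(l', r') \<in> P \<Longrightarrow> Nt S \<notin> set r'" by auto
qed

lemma \<Sigma>_I: "Start \<in> \<Sigma>" "x \<in> V \<Longrightarrow> Orig x \<in> \<Sigma>" "(l, r) \<in> Q \<Longrightarrow> i < length l \<Longrightarrow> Mark l r i \<in> \<Sigma>"
  unfolding \<Sigma>_def by auto

lemma S_V: "Nt S \<in> V" using S_in by (simp add: V_def)

lemma Q_nth: "(l, r) \<in> Q \<Longrightarrow> i < length l \<Longrightarrow> l ! i \<in> V"
  using Q_props(3) nth_mem by blast

lemma piece_props:
  assumes "(l, r) \<in> Q" "i < length l"
  shows "piece l r i \<noteq> []" "set (piece l r i) \<subseteq> V"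
proof -
  have "i < length r" using Q_props(2)[OF assms(1)] assms(2) by simp
  then show "piece l r i \<noteq> []" by (simp add: piece_def)
  have "set (piece l r i) \<subseteq> set r"
    using \<open>i < length r\<close> set_drop_subset[of i r] by (auto simp: piece_def)
  then show "set (piece l r i) \<subseteq> V" using Q_props(4)[OF assms(1)] by blast
qed

lemma concat_pieces:
  assumes "(l, r) \<in> Q"
  shows "concat (map (piece l r) [0..<length l]) = r"
  using pieces_eq[of "length l" r] Q_props[OF assms] unfolding piece_def by simp

lemma e_eq: "x \<in> \<Sigma> \<Longrightarrow> y \<in> \<Sigma> \<Longrightarrow> e x = e y \<longleftrightarrow> x = y"
  using inj by (auto simp: inj_on_def)

lemma rulesI:
  "(e Start, [n (Orig (Nt S))]) \<in> rules"
  "x \<in> V \<Longrightarrow> (e (Orig x), [n (Orig x)]) \<in> rules"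
  "a \<in> T \<Longrightarrow> (e (Orig (Tm a)), [Tm a]) \<in> rules"
  unfolding rules_def by auto

lemma rulesI_mark:
  assumes "(l, r) \<in> Q" "i < length l"
  shows "(e (Orig (l ! i)), [n (Mark l r i)]) \<in> rules"
    and "(e (Mark l r i), map (\<lambda>x. n (Orig x)) (piece l r i)) \<in> rules"
  unfolding rules_def using assms by fastforce+

lemma rules_cases:
  assumes "(A, w) \<in> rules"
  obtains "A = e Start" "w = [n (Orig (Nt S))]"
  | "A = e Start" "w = []" "([Nt S], []) \<in> P"
  | x where "x \<in> V" "A = e (Orig x)" "w = [n (Orig x)]"
  | a where "a \<in> T" "A = e (Orig (Tm a))" "w = [Tm a]"
  | l r i where "(l, r) \<in> Q" "i < length l" "A = e (Orig (l ! i))" "w = [n (Mark l r i)]"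
  | l r i where "(l, r) \<in> Q" "i < length l" "A = e (Mark l r i)"
      "w = map (\<lambda>x. n (Orig x)) (piece l r i)"
  using assms unfolding rules_def by (auto split: if_splits)

lemma Tm_V: "a \<in> T \<Longrightarrow> Tm a \<in> V"
  by (simp add: V_def)

lemma tc: "tc_grammar (e ` \<Sigma>, T, rules, e Start) control"
proof -
  have finite_\<Sigma>: "finite \<Sigma>" unfolding \<Sigma>_def using finite_V finite_Q by auto
  have finite_rules: "finite rules" unfolding rules_def using finite_V finite_T finite_Q by auto
  have "finite U" unfolding U_def using finite_V finite_Q by simp
  then have reg: "regular control"
    using star_in_RL_V[of U 1] by (simp add: control_def RL_V_def)
  have orig: "n (Orig x) \<in> Nt ` e ` \<Sigma>" if "x \<in> V" for x using that \<Sigma>_I(2) by simp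
  have mark: "n (Mark l r i) \<in> Nt ` e ` \<Sigma>" if "(l, r) \<in> Q" "i < length l" for l r i
    using that \<Sigma>_I(3) by simp
  have rule: "A \<in> e ` \<Sigma> \<and> syms_in (e ` \<Sigma>) T w \<and> n Start \<notin> set w \<and> (w = [] \<longrightarrow> A = e Start)"
    if "(A, w) \<in> rules" for A w
    using that
  proof (cases rule: rules_cases)
    case 1
    then show ?thesis using \<Sigma>_I S_V by (auto simp: syms_in_iff e_eq)
  next
    case 2
    then show ?thesis using \<Sigma>_I by (auto simp: syms_in_iff)
  next
    case (3 x)
    then show ?thesis using \<Sigma>_I by (auto simp: syms_in_iff e_eq)
  next
    case (4 a)
    then show ?thesis using \<Sigma>_I(2)[OF Tm_V] by (auto simp: syms_in_iff)
  next
    case (5 l r i)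
    then show ?thesis using \<Sigma>_I Q_nth by (auto simp: syms_in_iff e_eq)
  next
    case (6 l r i)
    have "x \<in> V" if "x \<in> set (piece l r i)" for x using piece_props 6 that by blast
    then show ?thesis using 6 \<Sigma>_I piece_props[OF 6(1,2)] by (auto simp: syms_in_iff e_eq)
  qed
  have "set u \<subseteq> Nt ` e ` \<Sigma>" if "u \<in> U" for u
    using that orig mark \<Sigma>_I(1) unfolding U_def block_def by auto
  then have "\<forall>w \<in> control. syms_in (e ` \<Sigma>) T w"
    unfolding control_def syms_in_iff by fastforce
  then show ?thesis
    using finite_\<Sigma> finite_rules finite_T reg rule \<Sigma>_I(1) unfolding tc_grammar_def by fast
qed

section \<open>Every level decodes to a sentential form\<close>

fun base :: "'t csym \<Rightarrow> 't sym" where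
  "base Start = Nt S"
| "base (Orig x) = x"
| "base (Mark l r i) = l ! i"

text \<open>The simulated symbol. A marker still stands for the symbol it replaced, so marking
  leaves the decoded word unchanged and the derivation step takes place when the markers are
  resolved.\<close>

fun decode :: "'t cell \<Rightarrow> 't sym" where
  "decode (Act (Nt k)) = base (inv_into \<Sigma> e k)"
| "decode (Act (Tm a)) = Tm a"
| "decode (Old a) = Tm a"

lemma decode_n [simp]: "x \<in> \<Sigma> \<Longrightarrow> decode (Act (n x)) = base x"
  using inj by simp

declare decode.simps(1) [simp del]

lemma expand_Start: "expand rules (Act (n Start)) w \<Longrightarrow> w = [Act (n (Orig (Nt S)))]"
  by (erule expand_NtE, erule rules_cases) (use \<Sigma>_I Tm_V Q_nth in \<open>auto simp: e_eq\<close>)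

text \<open>The choices are renewal, marking and, for a letter, termination; none of them changes
  the decoded symbol.\<close>

lemma expand_Orig:
  assumes "x \<in> V" "expand rules (Act (n (Orig x))) w"
  shows "\<exists>y. w = [Act y] \<and> decode (Act y) = x"
proof -
  obtain v where v: "w = map Act v" "(e (Orig x), v) \<in> rules" using assms(2) by (rule expand_NtE)
  from v(2) show ?thesis
    by (cases rule: rules_cases)
      (use v(1) assms(1) \<Sigma>_I Tm_V Q_nth in \<open>auto simp: e_eq\<close>)
qed

lemma expand_Mark:
  assumes "(l, r) \<in> Q" "i < length l" "expand rules (Act (n (Mark l r i))) w"
  shows "w = map (\<lambda>x. Act (n (Orig x))) (piece l r i)"
proof -
  obtain v where v: "w = map Act v" "(e (Mark l r i), v) \<in> rules" using assms(3) by (rule expand_NtE)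
  from v(2) show ?thesis
    by (cases rule: rules_cases)
      (use v(1) assms(1,2) \<Sigma>_I Tm_V Q_nth in \<open>auto simp: e_eq\<close>)
qed

text \<open>Stated for any list of positions to allow induction; the full list
  \<open>[0..<length l]\<close> yields \<open>r\<close>.\<close>

lemma par_Marks:
  assumes "(l, r) \<in> Q" "set is \<subseteq> {..<length l}" "par rules (map (\<lambda>i. Act (n (Mark l r i))) is) d"
  shows "d = map (\<lambda>x. Act (n (Orig x))) (concat (map (piece l r) is))"
  using assms(2,3)
proof (induction "is" arbitrary: d)
  case (Cons i "is")
  then obtain w d' where "d = w @ d'" "expand rules (Act (n (Mark l r i))) w"
    "par rules (map (\<lambda>i. Act (n (Mark l r i))) is) d'" by (auto simp: par_Cons)
  then show ?case using expand_Mark[OF assms(1)] Cons by auto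
qed simp

text \<open>Only a complete block of markers changes the decoded word, and it does so by one
  application of its rule.\<close>

lemma par_U:
  assumes "u \<in> U" "par rules (map Act u) d"
  shows "\<exists>v. d = map Act v \<and> (cs_step (N, T, P, S))\<^sup>*\<^sup>* (map decode (map Act u)) (map decode d)"
proof -
  consider "u = [n Start]" | x where "x \<in> V" "u = [n (Orig x)]" | l r where "(l, r) \<in> Q" "u = block l r"
    using assms(1) unfolding U_def by auto
  then show ?thesis
  proof cases
    case 1
    then have "d = map Act [n (Orig (Nt S))]" using assms(2) expand_Start by (simp add: par_single)
    then show ?thesis using 1 \<Sigma>_I S_V by (intro exI[of _ "[n (Orig (Nt S))]"]) simp
  next
    case (2 x)
    then obtain y where "d = [Act y]" "decode (Act y) = x"
      using assms(2) expand_Orig by (auto simp: par_single)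
    then show ?thesis using 2 \<Sigma>_I by (intro exI[of _ "[y]"]) simp
  next
    case (3 l r)
    then have "par rules (map (\<lambda>i. Act (n (Mark l r i))) [0..<length l]) d"
      using assms(2) by (simp add: block_def comp_def)
    from par_Marks[OF 3(1) _ this] have d: "d = map (\<lambda>x. Act (n (Orig x))) r"
      by (simp add: concat_pieces[OF 3(1)] atLeast0LessThan)
    have "map (\<lambda>x. decode (Act (n (Orig x)))) r = map (\<lambda>x. x) r"
      using Q_props(4)[OF 3(1)] \<Sigma>_I(2) by (intro map_cong) auto
    then have "map decode d = r" by (simp add: d comp_def)
    moreover have "map (\<lambda>i. decode (Act (n (Mark l r i)))) [0..<length l] = map ((!) l) [0..<length l]"
      using \<Sigma>_I(3)[OF 3(1)] by (intro map_cong) auto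
    then have "map decode (map Act u) = l"
      using 3(2) by (simp add: block_def comp_def map_nth)
    moreover have "cs_step (N, T, P, S) l r"
      using 3(1) by (intro cs_step_rule) (simp add: Q_def)
    ultimately show ?thesis using d by (intro exI[of _ "map (\<lambda>x. n (Orig x)) r"]) auto
  qed
qed

lemma par_control:
  assumes "us \<in> lists U" "par rules (map Act (concat us)) d"
  shows "\<exists>v. d = map Act v \<and>
    (cs_step (N, T, P, S))\<^sup>*\<^sup>* (map decode (map Act (concat us))) (map decode d)"
  using assms
proof (induction us arbitrary: d)
  case (Cons u us)
  then obtain d1 d2 where d: "d = d1 @ d2" "par rules (map Act u) d1" "par rules (map Act (concat us)) d2"
    using par_append1[of rules "map Act u" "map Act (concat us)" d] by auto
  obtain v1 v2 where "d1 = map Act v1" "d2 = map Act v2"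
    "(cs_step (N, T, P, S))\<^sup>*\<^sup>* (map decode (map Act u)) (map decode d1)"
    "(cs_step (N, T, P, S))\<^sup>*\<^sup>* (map decode (map Act (concat us))) (map decode d2)"
    using par_U[OF Cons.hyps(1) d(2)] Cons.IH[OF d(3)] by auto
  then show ?case using d(1) cs_steps_append
    by (intro exI[of _ "v1 @ v2"]) (simp del: map_map)
qed simp

text \<open>No \<open>Old\<close> cell ever arises: a level that is rewritten lies in
  \<open>control\<close>, whose words contain no terminal that could freeze.\<close>

lemma reach_sound:
  "reach rules control (e Start) c \<Longrightarrow>
    \<exists>v. c = map Act v \<and> (cs_step (N, T, P, S))\<^sup>*\<^sup>* [Nt S] (map decode c)"
proof (induction rule: reach.induct)
  case reach_start
  then show ?case using \<Sigma>_I by (intro exI[of _ "[n Start]"]) simp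
next
  case (reach_par c d)
  then obtain v where c: "c = map Act v" by blast
  then have "v \<in> control" using reach_par(2) by simp
  then obtain us where v: "us \<in> lists U" "v = concat us" by (auto simp: control_def)
  then obtain v' where "d = map Act v'" "(cs_step (N, T, P, S))\<^sup>*\<^sup>* (map decode c) (map decode d)"
    using par_control[OF v(1)] reach_par(3) c v(2) by blast
  moreover have "(cs_step (N, T, P, S))\<^sup>*\<^sup>* [Nt S] (map decode c)" using reach_par.IH by blast
  ultimately show ?case by (intro exI[of _ v']) (auto intro: rtranclp_trans)
qed

section \<open>Every derivation is simulated by levels\<close>

abbreviation orig :: "'t sym \<Rightarrow> 't cell" where "orig x \<equiv> Act (n (Orig x))"

lemma control_append: "u \<in> control \<Longrightarrow> v \<in> control \<Longrightarrow> u @ v \<in> control"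
  unfolding control_def by (auto simp flip: concat_append intro!: imageI)

lemma U_control: "u \<in> U \<Longrightarrow> u \<in> control"
  unfolding control_def by (rule image_eqI[of _ _ "[u]"]) auto

lemma orig_control: "set u \<subseteq> V \<Longrightarrow> level_word (map orig u) \<in> control"
proof (induction u)
  case Nil
  have "concat [] \<in> control" unfolding control_def by (rule imageI) simp
  then show ?case by simp
next
  case (Cons x u)
  then have "[n (Orig x)] \<in> control" by (intro U_control) (simp add: U_def)
  then show ?case using Cons control_append[of "[n (Orig x)]" "level_word (map orig u)"] by simp
qed

lemma par_map: "(\<And>x. x \<in> set u \<Longrightarrow> expand P' (f x) (g x)) \<Longrightarrow> par P' (map f u) (concat (map g u))"
  by (induction u) (auto simp: par_Cons)

lemma par_orig:
  assumes "set u \<subseteq> V"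
  shows "par rules (map orig u) (map orig u)"
proof -
  have "expand rules (orig x) [orig x]" if "x \<in> set u" for x
    using expand_Nt[OF rulesI(2)] assms that by fastforce
  then have "par rules (map orig u) (concat (map (\<lambda>x. [orig x]) u))" by (rule par_map)
  then show ?thesis by (simp only: concat_map_singleton)
qed

lemma par_mark:
  assumes "(l, r) \<in> Q"
  shows "par rules (map orig l) (map Act (block l r))"
proof -
  have "expand rules (orig (l ! i)) [Act (n (Mark l r i))]" if "i < length l" for i
    using expand_Nt[OF rulesI_mark(1)[OF assms that]] by simp
  then have "par rules (map (\<lambda>i. orig (l ! i)) [0..<length l])
      (concat (map (\<lambda>i. [Act (n (Mark l r i))]) [0..<length l]))"
    by (intro par_map) simp
  moreover have "map (\<lambda>i. orig (l ! i)) [0..<length l] = map orig l"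
    by (rule nth_equalityI) auto
  ultimately show ?thesis by (simp add: block_def comp_def concat_map_singleton)
qed

lemma par_unmark:
  assumes "(l, r) \<in> Q"
  shows "par rules (map Act (block l r)) (map orig r)"
proof -
  have "expand rules (Act (n (Mark l r i))) (map orig (piece l r i))" if "i < length l" for i
    using expand_Nt[OF rulesI_mark(2)[OF assms that]] piece_props(1)[OF assms that]
    by (simp add: comp_def)
  then have "par rules (map (\<lambda>i. Act (n (Mark l r i))) [0..<length l])
      (concat (map (\<lambda>i. map orig (piece l r i)) [0..<length l]))"
    by (intro par_map) simp
  moreover have "concat (map (\<lambda>i. map orig (piece l r i)) [0..<length l]) = map orig r"
    using arg_cong[OF concat_pieces[OF assms], of "map orig"] by (simp add: map_concat comp_def)
  ultimately show ?thesis by (simp add: block_def comp_def)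
qed

text \<open>Two levels serve one rule application: \<open>l\<close> is marked, then the markers are
  resolved, while \<open>x\<close> and \<open>y\<close> renew themselves.\<close>

lemma reach_step:
  assumes "reach rules control (e Start) (map orig (x @ l @ y))" "set (x @ l @ y) \<subseteq> V" "(l, r) \<in> Q"
  shows "reach rules control (e Start) (map orig (x @ r @ y))"
proof -
  have V: "set x \<subseteq> V" "set y \<subseteq> V" using assms(2) by auto
  have "reach rules control (e Start) (map orig x @ map Act (block l r) @ map orig y)"
    using assms(1) orig_control[OF assms(2)]
    by (rule reach_par) (use V par_orig par_mark[OF assms(3)] in \<open>simp add: par_append\<close>)
  moreover have "level_word (map orig x @ map Act (block l r) @ map orig y) \<in> control"
    using V orig_control U_control[of "block l r"] assms(3)
    by (auto simp: U_def intro!: control_append simp del: map_map)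
  ultimately show ?thesis
    by (rule reach_par) (use V par_orig par_unmark[OF assms(3)] in \<open>simp add: par_append\<close>)
qed

text \<open>The last conjunct handles erasing: if \<open>S\<close> may be erased, it occurs on no
  right-hand side and never returns after the first step. The erasing rule can thus act only on the
  word \<open>[Nt S]\<close>.\<close>

lemma reach_complete:
  assumes "(cs_step (N, T, P, S))\<^sup>*\<^sup>* [Nt S] w"
  shows "if w = [] then ([Nt S], []) \<in> P
    else reach rules control (e Start) (map orig w) \<and> set w \<subseteq> V \<and>
      (([Nt S], []) \<in> P \<longrightarrow> w = [Nt S] \<or> Nt S \<notin> set w)"
  using assms
proof (induction rule: rtranclp_induct)
  case base
  have "expand rules (Act (n Start)) [orig (Nt S)]"
    using expand_Nt[OF rulesI(1)] by simp
  moreover have "level_word [Act (n Start)] \<in> control"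
    using U_control[of "[n Start]"] by (simp add: U_def)
  ultimately have "reach rules control (e Start) [orig (Nt S)]"
    using reach_par[OF reach_start] by (metis par_single)
  then show ?case using S_V by simp
next
  case (step u v)
  obtain x y l r where s: "(l, r) \<in> P" "u = x @ l @ y" "v = x @ r @ y"
    using step.hyps(2) by (auto simp: cs_step_def)
  show ?case
  proof (cases "r = []")
    case True
    then have P: "([Nt S], []) \<in> P" "l = [Nt S]" using s erasing_rule by auto
    then have "u = [Nt S]" using step.IH s by (auto split: if_splits)
    then have "v = []" using s P True by (auto simp: append_eq_Cons_conv)
    then show ?thesis using P by simp
  next
    case False
    then have Q: "(l, r) \<in> Q" using s by (simp add: Q_def)
    have u: "u \<noteq> []" "v \<noteq> []" using False s Q_props[OF Q] by auto
    then have IH: "reach rules control (e Start) (map orig u)" "set u \<subseteq> V"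
      "([Nt S], []) \<in> P \<Longrightarrow> u = [Nt S] \<or> Nt S \<notin> set u" using step.IH by auto
    have "Nt S \<notin> set v" if P: "([Nt S], []) \<in> P"
    proof -
      have "Nt S \<notin> set r" using erasing_rule(2)[OF P] s(1) by blast
      moreover have "Nt S \<notin> set x" "Nt S \<notin> set y"
        using IH(3)[OF P] s(2) Q_props(1)[OF Q] by (auto simp: append_eq_Cons_conv)
      ultimately show ?thesis using s(3) by simp
    qed
    then show ?thesis
      using u reach_step[OF _ _ Q] IH(1,2) s Q_props(4)[OF Q] by auto
  qed
qed

lemma nil_in_cs_lang: "([Nt S], []) \<in> P \<Longrightarrow> [] \<in> cs_lang (N, T, P, S)"
proof -
  assume "([Nt S], []) \<in> P"
  then have "cs_step (N, T, P, S) [Nt S] []" by (rule cs_step_rule)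
  then show ?thesis by (auto simp: cs_lang_def)
qed

lemma start_rule_nil: "(e Start, []) \<in> rules \<longleftrightarrow> ([Nt S], []) \<in> P"
proof
  assume "(e Start, []) \<in> rules"
  then show "([Nt S], []) \<in> P"
    by (cases rule: rules_cases) (use piece_props(1) in auto)
qed (simp add: rules_def)

lemma lang_eq: "tc_lang (e ` \<Sigma>, T, rules, e Start) control = cs_lang (N, T, P, S)"
proof -
  have start: "[n Start] \<in> control" by (rule U_control) (simp add: U_def)
  have "z \<in> cs_lang (N, T, P, S)" if c: "reach rules control (e Start) c" "spells c z" for c z
  proof -
    obtain v where v: "c = map Act v" "(cs_step (N, T, P, S))\<^sup>*\<^sup>* [Nt S] (map decode c)"
      using reach_sound[OF c(1)] by blast
    have "\<forall>(A, w) \<in> rules. syms_in (e ` \<Sigma>) T w" "e Start \<in> e ` \<Sigma>"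
      using tc by (auto simp: tc_grammar_def)
    from reach_cells[OF this c(1)] have "set c \<subseteq> cells (e ` \<Sigma>) T" .
    with c(2) have "map decode c = map Tm z \<and> set z \<subseteq> T"
      unfolding spells_def by (induction rule: list_all2_induct) (auto simp: cells_def)
    then show ?thesis using v by (simp add: cs_lang_def)
  qed
  moreover have "\<exists>c. reach rules control (e Start) c \<and> spells c z"
    if "z \<in> cs_lang (N, T, P, S)" "z \<noteq> []" for z
  proof -
    have z: "set z \<subseteq> T" "(cs_step (N, T, P, S))\<^sup>*\<^sup>* [Nt S] (map Tm z)"
      using that by (auto simp: cs_lang_def)
    then have r: "reach rules control (e Start) (map orig (map Tm z))" "set (map Tm z) \<subseteq> V"
      using reach_complete that(2) by fastforce+
    \<comment> \<open>One final level turns all letters into terminals at once; being the last, it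
      need not lie in \<open>control\<close>.\<close>
    have "expand rules (orig (Tm a)) [Act (Tm a)]" if "a \<in> set z" for a
      using expand_Nt[OF rulesI(3)] z(1) that by fastforce
    then have "par rules (map (\<lambda>a. orig (Tm a)) z) (concat (map (\<lambda>a. [Act (Tm a)]) z))"
      by (rule par_map)
    then have "reach rules control (e Start) (map (\<lambda>a. Act (Tm a)) z)"
      using reach_par[OF r(1) orig_control[OF r(2)]] by (simp add: comp_def concat_map_singleton)
    moreover have "spells (map (\<lambda>a. Act (Tm a)) z) z"
      by (simp add: spells_def list_all2_conv_all_nth)
    ultimately show ?thesis by blast
  qed
  moreover have "([Nt S], []) \<in> P" if "[] \<in> cs_lang (N, T, P, S)"
    using reach_complete[of "[]"] that by (simp add: cs_lang_def)
  ultimately show ?thesis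
    unfolding tc_lang_reach[OF tc] start_rule_nil using start nil_in_cs_lang by auto
qed

lemma finite_U: "finite U"
  unfolding U_def using finite_V finite_Q by simp

lemma lang_in_TC: "1 \<le> k \<Longrightarrow> cs_lang (N, T, P, S) \<in> TC (RL_V k)"
  using tc lang_eq star_in_RL_V[OF finite_U] unfolding TC_def control_def by blast

end

lemma CS_subset_TC:
  assumes "1 \<le> k"
  shows "CS \<subseteq> TC (RL_V k)"
proof
  fix L :: "'t list set"
  assume "L \<in> CS"
  then obtain N T P S where L: "cs_grammar (N, T, P, S)" "L = cs_lang (N, T, P, S)"
    unfolding CS_def by (auto simp: split_paired_Ex)
  let ?V = "Nt ` N \<union> Tm ` T" and ?Q = "P - UNIV \<times> {[]}"
  let ?\<Sigma> = "{Start} \<union> Orig ` ?V \<union> (\<Union>(l, r) \<in> ?Q. Mark l r ` {..<length l})"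
  have "finite N" "finite T" "finite P" using L(1) by (auto simp: cs_grammar_def)
  then have "finite ?\<Sigma>" by auto
  from finite_injection[OF this] obtain e :: "'t csym \<Rightarrow> nat" where "inj_on e ?\<Sigma>" ..
  then interpret cs_as_tc N T P S e ?V ?\<Sigma> ?Q
    using L(1) by unfold_locales auto
  show "L \<in> TC (RL_V k)" using lang_in_TC[OF assms] L(2) by simp
qed

section \<open>One-symbol rewriting that sees the neighbours and the ends of the word\<close>

definition last_opt :: "'x list \<Rightarrow> 'x option" where
  "last_opt u = (if u = [] then None else Some (last u))"

definition hd_opt :: "'x list \<Rightarrow> 'x option" where
  "hd_opt u = (if u = [] then None else Some (hd u))"

lemma last_opt_simps [simp]: "last_opt [] = None" "last_opt (u @ [x]) = Some x"
  by (auto simp: last_opt_def)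

lemma hd_opt_simps [simp]: "hd_opt [] = None" "hd_opt (x # u) = Some x"
  by (auto simp: hd_opt_def)

(* A neighbour None in a rule requires the end of the word; there is no wildcard. *)
definition nstep :: "('x option \<times> 'x \<times> 'x option \<times> 'x list) set \<Rightarrow> 'x list \<Rightarrow> 'x list \<Rightarrow> bool" where
  "nstep R a b = (\<exists>u x v w. (last_opt u, x, hd_opt v, w) \<in> R \<and> a = u @ [x] @ v \<and> b = u @ w @ v)"

(* A grammar cannot test for the ends of the word, so its symbols record whether they are first
   or last. *)
fun flag :: "bool \<Rightarrow> bool \<Rightarrow> 'x list \<Rightarrow> (bool \<times> bool \<times> 'x) list" where
  "flag f l [] = []"
| "flag f l [x] = [(f, l, x)]"
| "flag f l (x # y # u) = (f, False, x) # flag False l (y # u)"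

abbreviation unflag :: "(bool \<times> bool \<times> 'x) list \<Rightarrow> 'x list" where
  "unflag c \<equiv> map (\<lambda>(f, l, x). x) c"

lemma unflag_flag [simp]: "unflag (flag f l u) = u"
  by (induction f l u rule: flag.induct) auto

lemma flag_Nil_iff [simp]: "flag f l u = [] \<longleftrightarrow> u = []"
  by (cases "(f, l, u)" rule: flag.cases) auto

lemma length_flag [simp]: "length (flag f l u) = length u"
  by (metis length_map unflag_flag)

lemma flag_append: "flag f l (u @ v) = flag f (l \<and> v = []) u @ flag (f \<and> u = []) l v"
proof (induction f l u rule: flag.induct)
  case (2 f l x)
  then show ?case by (cases v) auto
qed auto

text \<open>Flags are determined by positions: removing them from both parts and flagging anew
  restores the word, and equal lengths identify the parts.\<close>

lemma flag_eq_append: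
  assumes "flag f l u = p @ q"
  shows "p = flag f (l \<and> q = []) (unflag p)" "q = flag (f \<and> p = []) l (unflag q)"
proof -
  have "u = unflag p @ unflag q" using assms by (metis map_append unflag_flag)
  then have eq: "p @ q = flag f (l \<and> q = []) (unflag p) @ flag (f \<and> p = []) l (unflag q)"
    using assms flag_append[of f l "unflag p" "unflag q"] by simp
  have len: "length p = length (flag f (l \<and> q = []) (unflag p))" by simp
  note iffD1[OF append_eq_append_conv[OF disjI1[OF len]] eq]
  then show "p = flag f (l \<and> q = []) (unflag p)" "q = flag (f \<and> p = []) l (unflag q)"
    by (blast dest: conjunct1 conjunct2)+
qed

text \<open>A left neighbour is never last, which fixes one of its flags. Whether it is first is
  unknown, so each rule is instantiated for both values of \<open>f\<close>; the right neighbour is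
  symmetric.\<close>

fun left_context :: "bool \<Rightarrow> 'x option \<Rightarrow> (bool \<times> bool \<times> 'x) list" where
  "left_context f None = []"
| "left_context f (Some y) = [(f, False, y)]"

fun right_context :: "bool \<Rightarrow> 'x option \<Rightarrow> (bool \<times> bool \<times> 'x) list" where
  "right_context l None = []"
| "right_context l (Some y) = [(False, l, y)]"

lemma flag_last: "\<exists>p f. flag True False u = p @ left_context f (last_opt u)"
proof (cases u rule: rev_cases)
  case Nil
  then show ?thesis by simp
next
  case (snoc v y)
  then show ?thesis
    by (intro exI[of _ "flag True False v"] exI[of _ "v = []"]) (simp add: flag_append)
qed

lemma flag_hd: "\<exists>q l. flag False True u = right_context l (hd_opt u) @ q"
proof (cases u)
  case Nil
  then show ?thesis by simp
next
  case (Cons y v)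
  then show ?thesis
    using flag_append[of False True "[y]" v]
    by (intro exI[of _ "flag False True v"] exI[of _ "v = []"]) simp
qed

locale neighbour_system =
  fixes R :: "('x option \<times> 'x \<times> 'x option \<times> 'x list) set" and s :: 'x
    and F :: "'t \<Rightarrow> 'x" and T :: "'t set" and eps :: bool
    and X :: "'x set" and e :: "bool \<times> bool \<times> 'x \<Rightarrow> nat"
  defines "X \<equiv> {s} \<union> F ` T \<union> (\<Union>(a, x, b, w) \<in> R. set_option a \<union> {x} \<union> set_option b \<union> set w)"
  assumes finite_R: "finite R" and finite_T: "finite T"
    and nonempty: "(a, x, b, w) \<in> R \<Longrightarrow> w \<noteq> []"
    and inj: "inj_on e (UNIV \<times> UNIV \<times> X)"
begin

text \<open>\<open>Suc\<close> reserves the nonterminal 0 for a fresh start symbol, which may then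
  have an erasing rule.\<close>

abbreviation k :: "bool \<times> bool \<times> 'x \<Rightarrow> 't sym" where "k c \<equiv> Nt (Suc (e c))"

text \<open>A neighbour required to be \<open>None\<close> turns into a flag of the rewritten symbol
  itself.\<close>

definition lhs :: "bool \<Rightarrow> bool \<Rightarrow> 'x option \<Rightarrow> 'x \<Rightarrow> 'x option \<Rightarrow> (bool \<times> bool \<times> 'x) list" where
  "lhs f l a x b = left_context f a @ [(a = None, b = None, x)] @ right_context l b"

definition rhs :: "bool \<Rightarrow> bool \<Rightarrow> 'x option \<Rightarrow> 'x list \<Rightarrow> 'x option \<Rightarrow> (bool \<times> bool \<times> 'x) list" where
  "rhs f l a w b = left_context f a @ flag (a = None) (b = None) w @ right_context l b"

definition P :: "('t sym list \<times> 't sym list) set" where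
  "P = {([Nt 0], [k (True, True, s)])} \<union> (if eps then {([Nt 0], [])} else {})
    \<union> (\<lambda>(f, l, a). ([k (f, l, F a)], [Tm a])) ` (UNIV \<times> UNIV \<times> T)
    \<union> (\<lambda>(f, l, a, x, b, w). (map k (lhs f l a x b), map k (rhs f l a w b))) ` (UNIV \<times> UNIV \<times> R)"

definition NN :: "nat set" where
  "NN = insert 0 (Suc ` e ` (UNIV \<times> UNIV \<times> X))"

abbreviation "G \<equiv> (NN, T, P, 0 :: nat)"

lemma P_cases:
  assumes "(l, r) \<in> P"
  obtains "l = [Nt 0]" "r = [k (True, True, s)]"
  | "l = [Nt 0]" "r = []" eps
  | f g a where "a \<in> T" "l = [k (f, g, F a)]" "r = [Tm a]"
  | f g a x b w where "(a, x, b, w) \<in> R" "l = map k (lhs f g a x b)" "r = map k (rhs f g a w b)"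
proof -
  consider "(l, r) \<in> {([Nt 0], [k (True, True, s)])}" | "(l, r) \<in> (if eps then {([Nt 0], [])} else {})"
    | "(l, r) \<in> (\<lambda>(f, l, a). ([k (f, l, F a)], [Tm a])) ` (UNIV \<times> UNIV \<times> T)"
    | "(l, r) \<in> (\<lambda>(f, l, a, x, b, w). (map k (lhs f l a x b), map k (rhs f l a w b))) ` (UNIV \<times> UNIV \<times> R)"
    using assms unfolding P_def by blast
  then show ?thesis
  proof cases
    case 1
    then show ?thesis using that(1) by simp
  next
    case 2
    then show ?thesis using that(2) by (simp split: if_splits)
  next
    case 3
    then obtain f g a where "a \<in> T" "l = [k (f, g, F a)]" "r = [Tm a]" by auto
    then show ?thesis using that(3) by blast
  next
    case 4
    then obtain f g a x b w where "(a, x, b, w) \<in> R" "l = map k (lhs f g a x b)"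
      "r = map k (rhs f g a w b)" by auto
    then show ?thesis using that(4) by blast
  qed
qed

lemma P_I:
  "([Nt 0], [k (True, True, s)]) \<in> P"
  "eps \<Longrightarrow> ([Nt 0], []) \<in> P"
  unfolding P_def by simp_all

lemma P_I_Tm: "a \<in> T \<Longrightarrow> ([k (f, l, F a)], [Tm a]) \<in> P"
  unfolding P_def by (rule UnI1, rule UnI2, rule image_eqI[of _ _ "(f, l, a)"]) simp_all

lemma P_I_R: "(a, x, b, w) \<in> R \<Longrightarrow> (map k (lhs f l a x b), map k (rhs f l a w b)) \<in> P"
  unfolding P_def by (rule UnI2, rule image_eqI[of _ _ "(f, l, a, x, b, w)"]) simp_all

lemma X_I: "s \<in> X" "a \<in> T \<Longrightarrow> F a \<in> X"
  unfolding X_def by auto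

lemma X_I_R:
  assumes "(a, x, b, w) \<in> R"
  shows "set_option a \<subseteq> X" "x \<in> X" "set_option b \<subseteq> X" "set w \<subseteq> X"
  using assms unfolding X_def by fastforce+

lemma set_flag: "set (flag f l u) \<subseteq> UNIV \<times> UNIV \<times> set u"
  by (induction f l u rule: flag.induct) auto

lemma lhs_rhs_X:
  assumes "(a, x, b, w) \<in> R"
  shows "set (lhs f l a x b) \<subseteq> UNIV \<times> UNIV \<times> X" "set (rhs f l a w b) \<subseteq> UNIV \<times> UNIV \<times> X"
proof -
  have "set (left_context f a) \<subseteq> UNIV \<times> UNIV \<times> X" "set (right_context l b) \<subseteq> UNIV \<times> UNIV \<times> X"
    using X_I_R[OF assms] by (cases a; cases b; simp)+
  then show "set (lhs f l a x b) \<subseteq> UNIV \<times> UNIV \<times> X" "set (rhs f l a w b) \<subseteq> UNIV \<times> UNIV \<times> X"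
    using X_I_R[OF assms] set_flag[of "a = None" "b = None" w] unfolding lhs_def rhs_def by auto
qed

lemma k_NN: "set c \<subseteq> UNIV \<times> UNIV \<times> X \<Longrightarrow> syms_in NN T (map k c)"
  unfolding syms_in_iff NN_def by auto

lemma cs: "cs_grammar G"
proof -
  have finite_X: "finite X" unfolding X_def using finite_R finite_T by auto
  have finite_P: "finite P" unfolding P_def using finite_R finite_T by simp
  have no_start: "Nt 0 \<notin> set r" if "(l, r) \<in> P" for l r
    using that by (cases rule: P_cases) auto
  then have no_start': "\<forall>(l', r') \<in> P. Nt 0 \<notin> set r'" by auto
  have rule: "syms_in NN T l \<and> syms_in NN T r \<and>
      ((\<exists>x y A w. A \<in> NN \<and> w \<noteq> [] \<and> l = x @ [Nt A] @ y \<and> r = x @ w @ y) \<or>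
       (l = [Nt 0] \<and> r = [] \<and> (\<forall>(l', r') \<in> P. Nt 0 \<notin> set r')))"
    if "(l, r) \<in> P" for l r
    using that
  proof (cases rule: P_cases)
    case 1
    then have "l = [] @ [Nt 0] @ [] \<and> r = [] @ r @ []" "r \<noteq> []" "(0::nat) \<in> NN" by (simp_all add: NN_def)
    moreover have "syms_in NN T l" "syms_in NN T r"
      using 1 k_NN[of "[(True, True, s)]"] X_I by (simp_all add: syms_in_def NN_def)
    ultimately show ?thesis by blast
  next
    case 2
    then show ?thesis using no_start' by (simp add: syms_in_def NN_def)
  next
    case (3 f g a)
    have "Suc (e (f, g, F a)) \<in> NN" using 3(1) X_I(2) unfolding NN_def by simp
    moreover have "l = [] @ [k (f, g, F a)] @ [] \<and> r = [] @ r @ []" "r \<noteq> []" using 3 by simp_all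
    moreover have "syms_in NN T l" "syms_in NN T r"
      using 3 k_NN[of "[(f, g, F a)]"] X_I by (simp_all add: syms_in_def)
    ultimately show ?thesis by blast
  next
    case (4 f g a x b w)
    let ?A = "Suc (e (a = None, b = None, x))"
    have "?A \<in> NN" using X_I_R(2)[OF 4(1)] unfolding NN_def by simp
    moreover have "l = map k (left_context f a) @ [Nt ?A] @ map k (right_context g b)"
      "r = map k (left_context f a) @ map k (flag (a = None) (b = None) w) @ map k (right_context g b)"
      using 4 by (simp_all add: lhs_def rhs_def)
    moreover have "map k (flag (a = None) (b = None) w) \<noteq> []" using nonempty[OF 4(1)] by simp
    moreover have "syms_in NN T l" "syms_in NN T r"
      using 4 k_NN lhs_rhs_X[OF 4(1)] by simp_all
    ultimately show ?thesis by blast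
  qed
  have "finite NN" "(0::nat) \<in> NN" unfolding NN_def using finite_X by simp_all
  then show ?thesis
    unfolding cs_grammar_def prod.case
    by (intro conjI finite_T finite_P) (assumption | clarify, rule rule)+
qed

(* A terminal no longer carries its flags; the invariant allows any flags for it. *)
definition matches :: "'t sym \<Rightarrow> bool \<times> bool \<times> 'x \<Rightarrow> bool" where
  "matches y c = (y = k c \<or> (\<exists>a \<in> T. y = Tm a \<and> snd (snd c) = F a))"

text \<open>A coded symbol is not a terminal and the code is injective, so it matches nothing but
  itself.\<close>

lemma matches_k:
  assumes "list_all2 matches (map k m) c" "set m \<subseteq> UNIV \<times> UNIV \<times> X" "set c \<subseteq> UNIV \<times> UNIV \<times> X"
  shows "c = m"
  using assms
proof (induction m arbitrary: c)
  case (Cons y m)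
  then obtain y' c' where c: "c = y' # c'" "matches (k y) y'" "list_all2 matches (map k m) c'"
    by (auto simp: list_all2_Cons1)
  then have "e y = e y'" by (simp add: matches_def)
  then have "y = y'" using inj Cons.prems c(1) by (simp add: inj_on_eq_iff)
  then show ?case using Cons c by simp
qed simp

lemma matches_map_k: "list_all2 matches (map k m) m"
  by (induction m) (simp_all add: matches_def)

text \<open>In a flagged word the flags are true to position. An occurrence of a coded left-hand
  side therefore certifies the neighbours and ends that the rule demands, and the replacement keeps
  the flags correct because the nonempty \<open>w\<close> inherits the end flags of
  \<open>x\<close>.\<close>

lemma context_neighbours:
  assumes "flag True True u = p @ lhs f l a x b @ q"
  defines "p' \<equiv> unflag (p @ left_context f a)" and "q' \<equiv> unflag (right_context l b @ q)"
  shows "u = p' @ [x] @ q'" "last_opt p' = a" "hd_opt q' = b"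
    "w \<noteq> [] \<Longrightarrow> flag True True (p' @ w @ q') = p @ rhs f l a w b @ q"
proof -
  let ?p = "p @ left_context f a" and ?q = "right_context l b @ q"
  have eq: "flag True True u = ?p @ (a = None, b = None, x) # ?q"
    using assms(1) by (simp add: lhs_def)
  show u: "u = p' @ [x] @ q'"
    using arg_cong[OF eq, of unflag] unfolding p'_def q'_def by simp
  have p: "?p = flag True False p'"
    using flag_eq_append(1)[OF eq] unfolding p'_def by simp
  have eq': "flag True True u = (?p @ [(a = None, b = None, x)]) @ ?q" using eq by simp
  have q: "?q = flag False True q'"
    using flag_eq_append(2)[OF eq'] unfolding q'_def by simp
  have "flag True True u = ?p @ (p' = [], q' = [], x) # ?q"
    unfolding u flag_append p q by (auto simp: flag_append)
  then have ab: "a = None \<longleftrightarrow> p' = []" "b = None \<longleftrightarrow> q' = []" using eq by auto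
  then show "last_opt p' = a" by (cases a) (auto simp: p'_def)
  show "hd_opt q' = b" using ab by (cases b) (auto simp: q'_def)
  show "flag True True (p' @ w @ q') = p @ rhs f l a w b @ q" if "w \<noteq> []"
  proof -
    have "flag True True (p' @ w @ q') = ?p @ flag (a = None) (b = None) w @ ?q"
      using that unfolding p q ab flag_append by simp
    then show ?thesis by (simp add: rhs_def)
  qed
qed

text \<open>Letters may become terminals while other symbols are still being rewritten. The word
  \<open>u\<close> keeps \<open>F a\<close> in their place, so its derivation is unaffected; a
  terminal occurs in no left-hand side and can only block rules.\<close>

definition good :: "'t sym list \<Rightarrow> bool" where
  "good z = (\<exists>u. (nstep R)\<^sup>*\<^sup>* [s] u \<and> set u \<subseteq> X \<and> list_all2 matches z (flag True True u))"

lemma good_step: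
  assumes "good z" "cs_step G z z'"
  shows "good z'"
proof -
  obtain u where u: "(nstep R)\<^sup>*\<^sup>* [s] u" "set u \<subseteq> X" "list_all2 matches z (flag True True u)"
    using assms(1) by (auto simp: good_def)
  obtain p q l r where z: "(l, r) \<in> P" "z = p @ l @ q" "z' = p @ r @ q"
    using assms(2) by (auto simp: cs_step_def)
  obtain p' m q' where c: "flag True True u = p' @ m @ q'"
    "list_all2 matches p p'" "list_all2 matches l m" "list_all2 matches q q'"
    using u(3) unfolding z(2) by (auto simp: list_all2_append1)
  have X: "set (p' @ m @ q') \<subseteq> UNIV \<times> UNIV \<times> X"
    using set_flag[of True True u] u(2) unfolding c(1) by fast
  from z(1) show ?thesis
  proof (cases rule: P_cases)
    case 1
    then show ?thesis using c(3) by (auto simp: list_all2_Cons1 matches_def)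
  next
    case 2
    then show ?thesis using c(3) by (auto simp: list_all2_Cons1 matches_def)
  next
    case (3 f g a)
    have "m = [(f, g, F a)]"
      using matches_k[of "[(f, g, F a)]" m] c(3) 3 X X_I(2) by simp
    then have "list_all2 matches r m" using 3 by (simp add: matches_def)
    then have "list_all2 matches z' (flag True True u)"
      unfolding z(3) c(1) using c by (intro list_all2_appendI)
    then show ?thesis using u unfolding good_def by blast
  next
    case (4 f g a x b w)
    have "m = lhs f g a x b"
      using matches_k[of "lhs f g a x b" m] c(3) 4 X lhs_rhs_X[OF 4(1)] by simp
    note n = context_neighbours[OF c(1)[unfolded this]]
    let ?p = "unflag (p' @ left_context f a)" and ?q = "unflag (right_context g b @ q')"
    have "nstep R u (?p @ w @ ?q)"
      unfolding nstep_def using n(1,2,3) 4(1)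
      by (intro exI[of _ ?p] exI[of _ x] exI[of _ ?q] exI[of _ w]) simp
    moreover have "set (?p @ w @ ?q) \<subseteq> X"
      using u(2) n(1) X_I_R(4)[OF 4(1)] by simp
    moreover have "flag True True (?p @ w @ ?q) = p' @ rhs f g a w b @ q'"
      using n(4) nonempty[OF 4(1)] by blast
    then have "list_all2 matches z' (flag True True (?p @ w @ ?q))"
      unfolding z(3) 4(3) using c matches_map_k by (simp only: list_all2_appendI)
    ultimately show ?thesis using u(1) unfolding good_def by (meson rtranclp.rtrancl_into_rtrancl)
  qed
qed

lemma sound:
  assumes "(cs_step G)\<^sup>*\<^sup>* [Nt 0] z"
  shows "z = [Nt 0] \<or> z = [] \<and> eps \<or> good z"
  using assms
proof (induction rule: rtranclp_induct)
  case (step z z')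
  consider "z = [Nt 0]" | "z = []" | "good z" using step.IH by blast
  then show ?case
  proof cases
    case 1
    obtain p q l r where s: "(l, r) \<in> P" "z = p @ l @ q" "z' = p @ r @ q"
      using step.hyps(2) by (auto simp: cs_step_def)
    have start: "good [k (True, True, s)]"
      unfolding good_def using X_I(1) by (intro exI[of _ "[s]"]) (simp add: matches_def)
    from s(1) show ?thesis
    proof (cases rule: P_cases)
      case 1
      then have "z' = [k (True, True, s)]"
        using s \<open>z = [Nt 0]\<close> by (auto simp: Cons_eq_append_conv)
      then show ?thesis using start by simp
    next
      case 2
      then have "z' = []" using s \<open>z = [Nt 0]\<close> by (auto simp: Cons_eq_append_conv)
      then show ?thesis using 2 by simp
    next
      case 3
      then show ?thesis using s \<open>z = [Nt 0]\<close> by (auto simp: Cons_eq_append_conv)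
    next
      case 4
      have "k y \<noteq> Nt 0" for y by simp
      moreover have "set l \<subseteq> {Nt 0}" using s(2) \<open>z = [Nt 0]\<close> by (metis Un_iff list.set(1) list.simps(15) set_append subsetI)
      ultimately show ?thesis using 4 by (simp add: lhs_def)
    qed
  next
    case 2
    then obtain l r where "(l, r) \<in> P" "l = []"
      using step.hyps(2) by (auto simp: cs_step_def)
    then show ?thesis by (cases rule: P_cases) (auto simp: lhs_def)
  next
    case 3
    then show ?thesis using good_step step.hyps(2) by blast
  qed
qed simp

lemma nstep_cs_step:
  assumes "nstep R a b"
  shows "cs_step G (map k (flag True True a)) (map k (flag True True b))"
proof -
  obtain u x v w where R: "(last_opt u, x, hd_opt v, w) \<in> R" "a = u @ [x] @ v" "b = u @ w @ v"
    using assms by (auto simp: nstep_def)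
  obtain p f where p: "flag True False u = p @ left_context f (last_opt u)"
    using flag_last by blast
  obtain q l where q: "flag False True v = right_context l (hd_opt v) @ q"
    using flag_hd by blast
  have ends: "u = [] \<longleftrightarrow> last_opt u = None" "v = [] \<longleftrightarrow> hd_opt v = None"
    by (auto simp: last_opt_def hd_opt_def)
  have "w \<noteq> []" using nonempty R(1) by blast
  then have "flag True True a = p @ lhs f l (last_opt u) x (hd_opt v) @ q"
    "flag True True b = p @ rhs f l (last_opt u) w (hd_opt v) @ q"
    using p q unfolding R(2,3) flag_append lhs_def rhs_def ends[symmetric] by simp_all
  then show ?thesis using P_I_R[OF R(1), of f l] unfolding cs_step_def by (auto simp del: map_map)
qed

lemma nsteps_cs_steps:
  assumes "(nstep R)\<^sup>*\<^sup>* [s] u"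
  shows "(cs_step G)\<^sup>*\<^sup>* [Nt 0] (map k (flag True True u))"
  using assms
proof (induction rule: rtranclp_induct)
  case base
  have "cs_step G [Nt 0] [k (True, True, s)]"
    using P_I(1) by (rule cs_step_rule)
  then show ?case by simp
next
  case (step a b)
  then show ?case using nstep_cs_step by (meson rtranclp.rtrancl_into_rtrancl)
qed

lemma letters_cs_steps:
  assumes "set z \<subseteq> T" "unflag c = map F z"
  shows "(cs_step G)\<^sup>*\<^sup>* (map k c) (map Tm z)"
  using assms
proof (induction z arbitrary: c)
  case (Cons a z)
  then obtain f l c' where c: "c = (f, l, F a) # c'" "unflag c' = map F z" by auto
  have "cs_step G [k (f, l, F a)] [Tm a]"
    using Cons.prems(1) by (intro cs_step_rule P_I_Tm) simp
  then show ?case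
    using cs_steps_append[of G "[k (f, l, F a)]" "[Tm a]"] Cons c by fastforce
qed simp

lemma lang: "cs_lang G = {z. set z \<subseteq> T \<and> (nstep R)\<^sup>*\<^sup>* [s] (map F z)} \<union> (if eps then {[]} else {})"
proof (intro equalityI subsetI)
  fix z assume "z \<in> cs_lang G"
  then have z: "set z \<subseteq> T" "(cs_step G)\<^sup>*\<^sup>* [Nt 0] (map Tm z)" by (auto simp: cs_lang_def)
  have "map Tm z \<noteq> [Nt 0]" by (cases z) simp_all
  then have "z = [] \<and> eps \<or> good (map Tm z)" using sound[OF z(2)] by simp
  then consider "z = []" "eps" | "good (map Tm z)" by blast
  then show "z \<in> {z. set z \<subseteq> T \<and> (nstep R)\<^sup>*\<^sup>* [s] (map F z)} \<union> (if eps then {[]} else {})"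
  proof cases
    case 2
    then obtain u where u: "(nstep R)\<^sup>*\<^sup>* [s] u" "list_all2 matches (map Tm z) (flag True True u)"
      by (auto simp: good_def)
    \<comment> \<open>A word of terminals determines the word that it matches.\<close>
    have "unflag c = map F z" if "list_all2 matches (map Tm z) c" for c
      using that by (induction z arbitrary: c) (auto simp: list_all2_Cons1 matches_def)
    then show ?thesis using u z(1) by fastforce
  qed auto
next
  fix z assume z: "z \<in> {z. set z \<subseteq> T \<and> (nstep R)\<^sup>*\<^sup>* [s] (map F z)} \<union> (if eps then {[]} else {})"
  show "z \<in> cs_lang G"
  proof (cases "z = [] \<and> eps")
    case True
    then have "([Nt 0], []) \<in> P" by (intro P_I(2)) simp
    then have "cs_step G [Nt 0] []" by (rule cs_step_rule)
    then show ?thesis using True by (auto simp: cs_lang_def)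
  next
    case False
    then have z': "set z \<subseteq> T" "(nstep R)\<^sup>*\<^sup>* [s] (map F z)" using z by (auto split: if_splits)
    have "(cs_step G)\<^sup>*\<^sup>* (map k (flag True True (map F z))) (map Tm z)"
      by (rule letters_cs_steps[OF z'(1)]) simp
    then have "(cs_step G)\<^sup>*\<^sup>* [Nt 0] (map Tm z)"
      using nsteps_cs_steps[OF z'(2)] by (rule rtranclp_trans[rotated])
    then show ?thesis using z'(1) by (simp add: cs_lang_def)
  qed
qed

end

lemma neighbour_system_in_CS:
  assumes "finite R" "finite T" "\<And>a x b w. (a, x, b, w) \<in> R \<Longrightarrow> w \<noteq> []"
  shows "{z. set z \<subseteq> T \<and> (nstep R)\<^sup>*\<^sup>* [s] (map F z)} \<union> (if eps then {[]} else {}) \<in> CS"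
proof -
  let ?X = "{s} \<union> F ` T \<union> (\<Union>(a, x, b, w) \<in> R. set_option a \<union> {x} \<union> set_option b \<union> set w)"
  have "finite ?X" using assms(1,2) by auto
  then have "finite ((UNIV :: bool set) \<times> (UNIV :: bool set) \<times> ?X)" by simp
  from finite_injection[OF this] obtain e :: "bool \<times> bool \<times> 'a \<Rightarrow> nat" where "inj_on e (UNIV \<times> UNIV \<times> ?X)"
    ..
  then interpret neighbour_system R s F T eps ?X e
    using assms by unfold_locales auto
  show ?thesis using cs lang unfolding CS_def by blast
qed

section \<open>Tree-controlled grammars as context-sensitive grammars\<close>

(* Swept b q: the cell is a child in the next level, and q is the residual of the control language
   by the part of the current level up to and including its parent. *)
datatype 't mode = Ready bool | Swept bool "'t sym list set"

datatype 't scell = Cell "'t cell" "'t mode" | Fin 't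

abbreviation ready :: "bool \<Rightarrow> 't cell \<Rightarrow> 't scell" where
  "ready b x \<equiv> Cell x (Ready b)"

abbreviation letter :: "'t cell \<Rightarrow> 't \<Rightarrow> bool" where
  "letter x a \<equiv> x = Act (Tm a) \<or> x = Old a"

text \<open>The left quotient by the contribution of the cell to the level word; a frozen letter
  contributes nothing.\<close>

fun delta :: "'t sym list set \<Rightarrow> 't cell \<Rightarrow> 't sym list set" where
  "delta q (Act x) = {v. x # v \<in> q}"
| "delta q (Old a) = q"

lemma delta_residual: "delta (residual R u) x = residual R (u @ visible x)"
  by (cases x) (auto simp: residual_def)

lemma residual_Nil: "residual R [] = R"
  by (simp add: residual_def)

text \<open>The residuals are left open: where one matters, namely in the rightmost swept cell, the
  invariant states it separately.\<close>

definition swept :: "bool \<Rightarrow> 't cell list \<Rightarrow> 't scell list \<Rightarrow> bool" where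
  "swept b = list_all2 (\<lambda>y s. \<exists>q. s = Cell y (Swept b q))"

lemma swept_Nil [simp]: "swept b d [] \<longleftrightarrow> d = []" "swept b [] M \<longleftrightarrow> M = []"
  by (auto simp: swept_def)

lemma swept_append: "swept b d M \<Longrightarrow> swept b d' M' \<Longrightarrow> swept b (d @ d') (M @ M')"
  unfolding swept_def by (rule list_all2_appendI)

lemma swept_map: "swept b w (map (\<lambda>y. Cell y (Swept b q)) w)"
  by (induction w) (auto simp: swept_def)

lemma swept_append2:
  assumes "swept b d (M @ s # M')"
  obtains d1 y q d2 where "d = d1 @ y # d2" "s = Cell y (Swept b q)" "swept b d1 M" "swept b d2 M'"
  using assms unfolding swept_def by (auto simp: list_all2_append2 list_all2_Cons2)

lemma swept_mem: "swept b d M \<Longrightarrow> s \<in> set M \<Longrightarrow> \<exists>y q. s = Cell y (Swept b q)"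
  by (metis split_list swept_append2)

lemma last_opt_SomeD: "last_opt u = Some x \<Longrightarrow> x \<in> set u"
  by (auto simp: last_opt_def split: if_splits)

lemma hd_opt_SomeD: "hd_opt u = Some x \<Longrightarrow> x \<in> set u"
  by (auto simp: hd_opt_def split: if_splits)

lemma last_opt_append: "last_opt (u @ v) = (if v = [] then last_opt u else last_opt v)"
  by (auto simp: last_opt_def)

lemma hd_opt_append: "hd_opt (u @ v) = (if u = [] then hd_opt v else hd_opt u)"
  by (auto simp: hd_opt_def)

lemma last_opt_None [simp]: "last_opt u = None \<longleftrightarrow> u = []"
  by (auto simp: last_opt_def)

lemma hd_opt_None [simp]: "hd_opt u = None \<longleftrightarrow> u = []"
  by (auto simp: hd_opt_def)

lemma spells_cells:
  assumes "spells c z" "set c \<subseteq> cells N T"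
  shows "set z \<subseteq> T"
  using assms unfolding spells_def by (induction rule: list_all2_induct) (auto simp: cells_def)

lemma append_eq_split:
  assumes "A @ B = p @ x # v"
  obtains v' where "A = p @ x # v'" "v = v' @ B" | p' where "p = A @ p'" "B = p' @ x # v"
  using assms by (auto simp: append_eq_append_conv2 Cons_eq_append_conv append_eq_Cons_conv)

locale tc_as_cs =
  fixes N :: "nat set" and T :: "'t set" and P S and R :: "'t sym list set"
  assumes G: "tc_grammar (N, T, P, S) R"
begin

text \<open>All children of a cell store the same residual, so the last of them can hand it on. The
  sweep back releases the leftmost cell last, and only there can a new sweep start. Finishing also
  starts at the left end and makes no test against \<open>R\<close>, since the last level is
  exempt.\<close>

inductive srule ::
  "'t scell option \<Rightarrow> 't scell \<Rightarrow> 't scell option \<Rightarrow> 't scell list \<Rightarrow> bool" where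
  sweep_first: "expand P x w \<Longrightarrow>
    srule None (Cell x (Ready b)) r (map (\<lambda>y. Cell y (Swept b (delta R x))) w)"
| sweep: "expand P x w \<Longrightarrow>
    srule (Some (Cell y (Swept b q))) (Cell x (Ready b)) r (map (\<lambda>y. Cell y (Swept b (delta q x))) w)"
| unsweep_last: "[] \<in> q \<Longrightarrow> srule l (Cell x (Swept b q)) None [Cell x (Ready (\<not> b))]"
| unsweep: "srule l (Cell x (Swept b q)) (Some (Cell y (Ready (\<not> b)))) [Cell x (Ready (\<not> b))]"
| finish_first: "letter x a \<Longrightarrow> srule None (Cell x (Ready b)) r [Fin a]"
| finish: "letter x a \<Longrightarrow> srule (Some (Fin a')) (Cell x (Ready b)) r [Fin a]"

definition scells :: "'t scell set" where
  "scells = (\<lambda>(x, m). Cell x m) `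
     (cells N T \<times> (range Ready \<union> (\<lambda>(b, q). Swept b q) ` (UNIV \<times> range (residual R)))) \<union> Fin ` T"

text \<open>The sum dominates every right-hand side in \<open>P\<close>; \<open>Suc\<close> leaves
  room for the one-cell words of the other rules.\<close>

definition K :: nat where
  "K = Suc (\<Sum>p\<in>P. length (snd p))"

text \<open>\<open>srule\<close> has infinitely many instances, as any set of words may serve as
  \<open>q\<close>. The restriction to \<open>scells\<close> is finite because \<open>R\<close> has
  finitely many residuals.\<close>

definition srules :: "('t scell option \<times> 't scell \<times> 't scell option \<times> 't scell list) set" where
  "srules = {(l, x, r, w). srule l x r w} \<inter>
     insert None (Some ` scells) \<times> scells \<times> insert None (Some ` scells) \<times>
     {w. set w \<subseteq> scells \<and> length w \<le> K}"

abbreviation "reaches \<equiv> reach P R S"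

lemma finite_N: "finite N" and finite_T: "finite T" and finite_P: "finite P" and S_in: "S \<in> N"
  and rhs_syms: "\<forall>(A, w) \<in> P. syms_in N T w" and regular_R: "regular R"
  using G by (auto simp: tc_grammar_def)

lemma finite_srules: "finite srules"
proof -
  have "finite (cells N T)" unfolding cells_def using finite_N finite_T by simp
  moreover have "finite ((UNIV :: bool set) \<times> range (residual R))"
    using finite_residuals[OF regular_R] by simp
  then have "finite (range Ready \<union> (\<lambda>(b, q). Swept b q) ` (UNIV \<times> range (residual R)))"
    by (simp only: finite_Un finite_imageI finite)
  ultimately have "finite scells"
    unfolding scells_def using finite_T by (simp only: finite_Un finite_imageI finite_cartesian_product)
  then have "finite (insert None (Some ` scells) \<times> scells \<times> insert None (Some ` scells) \<times>
     {w. set w \<subseteq> scells \<and> length w \<le> K})"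
    by (intro finite_cartesian_product finite_lists_length_le) simp_all
  then show ?thesis unfolding srules_def by (rule finite_Int[OF disjI2])
qed

section \<open>The sweeps produce only reachable words\<close>

lemma srule_nonempty: "srule l x r w \<Longrightarrow> w \<noteq> []"
  by (erule srule.cases) (auto dest: expand_nonempty)

lemma srulesD: "(l, x, r, w) \<in> srules \<Longrightarrow> srule l x r w"
  by (simp add: srules_def)

lemma srules_nonempty: "(l, x, r, w) \<in> srules \<Longrightarrow> w \<noteq> []"
  using srulesD srule_nonempty by blast

text \<open>\<open>c1\<close> is the part of the level already read and \<open>d\<close> its
  expansion; the level is not yet known to lie in \<open>R\<close>. The residual of the rightmost
  swept cell is the one that the next \<open>sweep\<close> or \<open>unsweep_last\<close>
  reads.\<close>

definition sweep_form :: "'t scell list \<Rightarrow> bool" where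
  "sweep_form u = (\<exists>c1 c2 d b M. reaches (c1 @ c2) \<and> par P c1 d \<and> u = M @ map (ready b) c2 \<and>
     swept b d M \<and> (\<forall>y q. last_opt M = Some (Cell y (Swept b q)) \<longrightarrow> q = residual R (level_word c1)))"

text \<open>Here the control test has been passed. With \<open>c\<close> empty it would still be
  open, and with \<open>d\<close> empty the word is ready and falls under
  \<open>sweep_form\<close>.\<close>

definition back_form :: "'t scell list \<Rightarrow> bool" where
  "back_form u = (\<exists>d c b M. reaches (d @ c) \<and> d \<noteq> [] \<and> c \<noteq> [] \<and> u = M @ map (ready (\<not> b)) c \<and> swept b d M)"

definition finish_form :: "'t scell list \<Rightarrow> bool" where
  "finish_form u = (\<exists>c1 c2 z b. reaches (c1 @ c2) \<and> c1 \<noteq> [] \<and> spells c1 z \<and>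
     u = map Fin z @ map (ready b) c2)"

lemma ready_form: "reaches c \<Longrightarrow> sweep_form (map (ready b) c)"
  unfolding sweep_form_def
  by (intro exI[of _ "[]"] exI[of _ c] exI[of _ b]) simp

lemma back_formI:
  assumes "reaches (d @ c)" "c \<noteq> []" "swept b d M"
  shows "sweep_form (M @ map (ready (\<not> b)) c) \<or> back_form (M @ map (ready (\<not> b)) c)"
proof (cases "d = []")
  case True
  then show ?thesis using assms ready_form[of c "\<not> b"] by simp
next
  case False
  then show ?thesis using assms unfolding back_form_def by blast
qed

lemma sweep_extend:
  assumes "reaches (c1 @ y # c2)" "par P c1 d" "swept b d M" "expand P y w"
    "q = residual R (level_word (c1 @ [y]))"
  shows "sweep_form (M @ map (\<lambda>y. Cell y (Swept b q)) w @ map (ready b) c2)"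
proof -
  have "reaches ((c1 @ [y]) @ c2)" using assms(1) by simp
  moreover have "par P (c1 @ [y]) (d @ w)" using assms(2,4) by (simp add: par_append par_single)
  moreover have "swept b (d @ w) (M @ map (\<lambda>y. Cell y (Swept b q)) w)"
    using assms(3) swept_map by (rule swept_append)
  moreover have "last_opt (M @ map (\<lambda>y. Cell y (Swept b q)) w) = Some (Cell (last w) (Swept b q))"
    using expand_nonempty[OF assms(4)] by (simp add: last_opt_def last_map)
  ultimately show ?thesis
    unfolding sweep_form_def using assms(5)
    by (intro exI[of _ "c1 @ [y]"] exI[of _ c2] exI[of _ "d @ w"] exI[of _ b]
        exI[of _ "M @ map (\<lambda>y. Cell y (Swept b q)) w"]) simp
qed

lemma sweep_form_step:
  assumes "sweep_form (p @ x # v)" "srule (last_opt p) x (hd_opt v) w"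
  shows "sweep_form (p @ w @ v) \<or> back_form (p @ w @ v) \<or> finish_form (p @ w @ v)"
proof -
  obtain c1 c2 d b M where u: "reaches (c1 @ c2)" "par P c1 d" "M @ map (ready b) c2 = p @ x # v"
    "swept b d M" "\<And>y q. last_opt M = Some (Cell y (Swept b q)) \<Longrightarrow> q = residual R (level_word c1)"
    using assms(1) unfolding sweep_form_def by metis
  \<comment> \<open>Expansion never yields the empty word, so a rule for the left end meets a ready
    cell only if nothing has been read.\<close>
  have c1: "M = [] \<Longrightarrow> c1 = []" using u(2,4) par_nonempty by auto
  from u(3) show ?thesis
  proof (cases rule: append_eq_split)
    case (1 v')
    obtain d1 y q d2 where s: "d = d1 @ y # d2" "x = Cell y (Swept b q)" "swept b d1 p" "swept b d2 v'"
      using u(4) 1(1) swept_append2 by metis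
    from assms(2) show ?thesis unfolding s(2)
    proof cases
      case unsweep_last
      then have v: "v' = []" "c2 = []" "d2 = []" using 1(2) s(4) by auto
      \<comment> \<open>The whole level has been read, so \<open>[]\<close> in the stored residual
        says that the level word lies in \<open>R\<close>.\<close>
      then have "last_opt M = Some (Cell y (Swept b q))" using 1(1) s(2) by simp
      then have "level_word c1 \<in> R" using u(5) unsweep_last by (auto simp: residual_def)
      then have "reaches (d1 @ [y])" using u(1,2) v s(1) reach_par by fastforce
      then show ?thesis using back_formI[of d1 "[y]" b p] s(3) unsweep_last v 1(2) by auto
    next
      \<comment> \<open>Impossible: the right neighbour would be ready with bit
        \<open>\<not> b\<close>, but the ready cells here have bit \<open>b\<close>.\<close>
      case (unsweep y')
      have "v' = []"
        using unsweep(1) swept_mem[OF s(4)] hd_opt_SomeD by (fastforce simp: 1(2) hd_opt_append split: if_splits)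
      then have "Cell y' (Ready (\<not> b)) \<in> set (map (ready b) c2)"
        using unsweep(1) hd_opt_SomeD 1(2) by fastforce
      then show ?thesis by auto
    qed
  next
    case (2 p')
    then obtain e1 y e2 where e: "c2 = e1 @ y # e2" "p' = map (ready b) e1" "x = ready b y" "v = map (ready b) e2"
      by (auto simp: map_eq_append_conv)
    from assms(2) show ?thesis unfolding e(3)
    proof cases
      case (sweep_first w')
      then have "p = []" "e1 = []" "M = []" using 2(1) e(2) by auto
      moreover have "residual R (level_word [y]) = delta R y"
        using delta_residual[of R "[]" y] by (simp add: residual_Nil)
      ultimately show ?thesis
        using sweep_extend[of "[]" y e2 "[]" b "[]" w'] u(1) c1 e sweep_first by simp
    next
      case (sweep w' y0 q)
      then have "Cell y0 (Swept b q) \<in> set p" by (simp add: last_opt_SomeD)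
      have "e1 = []"
        using sweep(1) last_opt_SomeD[of p'] by (auto simp: 2(1) e(2) last_opt_append split: if_splits)
      then have "p = M" using 2(1) e(2) by simp
      then have q: "q = residual R (level_word c1)" using u(5) sweep(1) by simp
      show ?thesis
        using sweep_extend[of c1 y e2 d b M w' "delta q y"] u(1,2,4) e \<open>e1 = []\<close> \<open>p = M\<close> sweep
        by (simp add: q delta_residual)
    next
      case (finish_first a)
      then have "p = []" "e1 = []" "M = []" using 2(1) e(2) by auto
      then have "finish_form (p @ w @ v)"
        unfolding finish_form_def using u(1) c1 e finish_first
        by (intro exI[of _ "[y]"] exI[of _ e2] exI[of _ "[a]"] exI[of _ b]) (auto simp: spells_def)
      then show ?thesis by blast
    next
      case (finish a a')
      have "Fin a' \<in> set M \<union> set p'" using finish(1) last_opt_SomeD 2(1) by fastforce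
      then show ?thesis using swept_mem[OF u(4)] e(2) by auto
    qed
  qed
qed

lemma back_form_step:
  assumes "back_form (p @ x # v)" "srule (last_opt p) x (hd_opt v) w"
  shows "sweep_form (p @ w @ v) \<or> back_form (p @ w @ v)"
proof -
  obtain d c b M where u: "reaches (d @ c)" "d \<noteq> []" "c \<noteq> []" "M @ map (ready (\<not> b)) c = p @ x # v"
    "swept b d M"
    using assms(1) unfolding back_form_def by metis
  from u(4) show ?thesis
  proof (cases rule: append_eq_split)
    case (1 v')
    obtain d1 y q d2 where s: "d = d1 @ y # d2" "x = Cell y (Swept b q)" "swept b d1 p" "swept b d2 v'"
      using u(5) 1(1) swept_append2 by metis
    from assms(2) show ?thesis unfolding s(2)
    proof cases
      case unsweep_last
      then show ?thesis using 1(2) u(3) by simp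
    next
      case (unsweep y')
      have "v' = []"
        using unsweep(1) swept_mem[OF s(4)] hd_opt_SomeD by (fastforce simp: 1(2) hd_opt_append split: if_splits)
      then show ?thesis
        using back_formI[of d1 "y # c" b p] u(1) s unsweep 1(2) by simp
    qed
  next
    case (2 p')
    then obtain e1 y e2 where e: "c = e1 @ y # e2" "p' = map (ready (\<not> b)) e1" "x = ready (\<not> b) y"
      by (auto simp: map_eq_append_conv)
    have "p \<noteq> []" using 2(1) u(2,5) by auto
    \<comment> \<open>No rule rewrites a ready cell with bit \<open>\<not> b\<close> behind such a
      neighbour: \<open>sweep\<close> wants equal bits and \<open>finish\<close> wants a
      \<open>Fin\<close>.\<close>
    have p: "(\<exists>y q. s = Cell y (Swept b q)) \<or> (\<exists>y. s = ready (\<not> b) y)" if "last_opt p = Some s" for s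
      using last_opt_SomeD[OF that] swept_mem[OF u(5)] unfolding 2(1) e(2) by auto
    from assms(2) show ?thesis unfolding e(3)
      by cases (use \<open>p \<noteq> []\<close> p in auto)
  qed
qed

lemma finish_form_step:
  assumes "finish_form (p @ x # v)" "srule (last_opt p) x (hd_opt v) w"
  shows "finish_form (p @ w @ v)"
proof -
  obtain c1 c2 z b where u: "reaches (c1 @ c2)" "c1 \<noteq> []" "spells c1 z"
    "map Fin z @ map (ready b) c2 = p @ x # v"
    using assms(1) unfolding finish_form_def by metis
  from u(4) show ?thesis
  proof (cases rule: append_eq_split)
    case (1 v')
    then have "x \<in> set (map Fin z)" by simp
    then obtain a where x: "x = Fin a" by auto
    from assms(2) show ?thesis unfolding x by cases
  next
    case (2 p')
    then obtain e1 y e2 where e: "c2 = e1 @ y # e2" "p' = map (ready b) e1" "x = ready b y" "v = map (ready b) e2"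
      by (auto simp: map_eq_append_conv)
    have "p \<noteq> []" using 2(1) u(2,3) by (auto simp: spells_def)
    have p: "s \<in> range Fin \<or> s \<in> range (ready b)" if "last_opt p = Some s" for s
      using last_opt_SomeD[OF that] unfolding 2(1) e(2) by auto
    from assms(2) show ?thesis unfolding e(3)
    proof cases
      case (finish a a')
      have "e1 = []"
        using finish(1) last_opt_SomeD[of p'] by (auto simp: 2(1) e(2) last_opt_append split: if_splits)
      moreover have "spells (c1 @ [y]) (z @ [a])"
        using u(3) finish by (intro spells_append) (auto simp: spells_def)
      ultimately show ?thesis
        unfolding finish_form_def using u(1) e 2(1) finish
        by (intro exI[of _ "c1 @ [y]"] exI[of _ e2] exI[of _ "z @ [a]"] exI[of _ b]) simp
    qed (use \<open>p \<noteq> []\<close> p in auto)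
  qed
qed

lemma nsteps_form:
  assumes "(nstep srules)\<^sup>*\<^sup>* [ready False (Act (Nt S))] u"
  shows "sweep_form u \<or> back_form u \<or> finish_form u"
  using assms
proof (induction rule: rtranclp_induct)
  case base
  show ?case using ready_form[OF reach_start, of False] by simp
next
  case (step a b)
  then obtain p x v w where s: "(last_opt p, x, hd_opt v, w) \<in> srules" "a = p @ x # v" "b = p @ w @ v"
    unfolding nstep_def by auto
  show ?case
    using step.IH srulesD[OF s(1)] sweep_form_step back_form_step finish_form_step
    unfolding s(2,3) by metis
qed

text \<open>A word of \<open>Fin\<close> cells has neither swept nor ready cells. In the first form
  the reached word would be empty, the second form requires a ready cell, so the third remains, with
  every letter finished.\<close>

lemma sound:
  assumes "(nstep srules)\<^sup>*\<^sup>* [ready False (Act (Nt S))] (map Fin z)"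
  shows "\<exists>c. reaches c \<and> spells c z"
proof -
  have fin: "c = []" if "map Fin z = M @ map (ready b) c" for M b c
    using arg_cong[OF that, of set] by (cases c) auto
  have swept: "M = []" if "map Fin z = M @ u" "swept b d M" for M u b d
    using arg_cong[OF that(1), of set] swept_mem[OF that(2)] by (cases M) auto
  consider "sweep_form (map Fin z)" | "back_form (map Fin z)" | "finish_form (map Fin z)"
    using nsteps_form[OF assms] by blast
  then show ?thesis
  proof cases
    case 1
    then obtain c1 c2 d b M where u: "reaches (c1 @ c2)" "par P c1 d" "map Fin z = M @ map (ready b) c2"
      "swept b d M" unfolding sweep_form_def by metis
    then have "c2 = []" "M = []" using fin swept by blast+
    then have "c1 = []" using u(2,4) par_nonempty by auto
    then show ?thesis using reach_nonempty[OF u(1)] \<open>c2 = []\<close> by simp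
  next
    case 2
    then show ?thesis using fin unfolding back_form_def by blast
  next
    case 3
    then obtain c1 c2 z' b where u: "reaches (c1 @ c2)" "spells c1 z'"
      "map Fin z = map Fin z' @ map (ready b) c2" unfolding finish_form_def by metis
    then have "c2 = []" using fin by blast
    moreover from this have "z = z'" using u(3) by (simp add: inj_map_eq_map inj_def)
    ultimately show ?thesis using u by auto
  qed
qed

section \<open>Every reachable word is produced by the sweeps\<close>

lemma scellsI:
  "x \<in> cells N T \<Longrightarrow> ready b x \<in> scells"
  "x \<in> cells N T \<Longrightarrow> Cell x (Swept b (residual R u)) \<in> scells"
  "a \<in> T \<Longrightarrow> Fin a \<in> scells"
proof -
  have "ready b x = (\<lambda>(x, m). Cell x m) (x, Ready b)"
    "Cell x (Swept b (residual R u)) = (\<lambda>(x, m). Cell x m) (x, (\<lambda>(b, q). Swept b q) (b, residual R u))"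
    by simp_all
  then show "x \<in> cells N T \<Longrightarrow> ready b x \<in> scells"
    "x \<in> cells N T \<Longrightarrow> Cell x (Swept b (residual R u)) \<in> scells" "a \<in> T \<Longrightarrow> Fin a \<in> scells"
    unfolding scells_def by blast+
qed

lemma nstepI:
  assumes "srule (last_opt p) x (hd_opt v) w" "set (p @ x # v) \<subseteq> scells" "set w \<subseteq> scells" "length w \<le> K"
  shows "nstep srules (p @ x # v) (p @ w @ v)"
proof -
  have "last_opt p \<in> insert None (Some ` scells)" "hd_opt v \<in> insert None (Some ` scells)"
    using assms(2) by (cases p rule: rev_cases; cases v; auto)+
  then have "(last_opt p, x, hd_opt v, w) \<in> srules" using assms unfolding srules_def by simp
  then show ?thesis unfolding nstep_def by (intro exI[of _ p] exI[of _ x] exI[of _ v] exI[of _ w]) simp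
qed

lemma expand_length: "expand P x w \<Longrightarrow> length w \<le> K"
proof (erule expand.cases)
  fix A v assume "(A, v) \<in> P" "w = map Act v"
  then show "length w \<le> K"
    using member_le_sum[of "(A, v)" P "\<lambda>p. length (snd p)"] finite_P by (simp add: K_def)
qed (simp_all add: K_def)

text \<open>The last step of the sweep is peeled off, with the unread suffix \<open>c2\<close>
  arbitrary. Membership in \<open>scells\<close> is carried along because \<open>srules\<close>
  offers its rules only within that alphabet.\<close>

lemma sweep_complete:
  assumes "set (c1 @ c2) \<subseteq> cells N T" "par P c1 d"
  shows "\<exists>M. (nstep srules)\<^sup>*\<^sup>* (map (ready b) (c1 @ c2)) (M @ map (ready b) c2) \<and> swept b d M \<and>
    set M \<subseteq> scells \<and> (c1 \<noteq> [] \<longrightarrow> (\<exists>y. last_opt M = Some (Cell y (Swept b (residual R (level_word c1))))))"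
  using assms
proof (induction c1 arbitrary: c2 d rule: rev_induct)
  case Nil
  then show ?case by (intro exI[of _ "[]"]) simp
next
  case (snoc x c1)
  then obtain d1 w where d: "d = d1 @ w" "par P c1 d1" "expand P x w"
    using par_append1[of P c1 "[x]" d] by (auto simp: par_single)
  have "set (c1 @ x # c2) \<subseteq> cells N T" using snoc.prems(1) by simp
  from snoc.IH[OF this d(2)] obtain M where
    M: "(nstep srules)\<^sup>*\<^sup>* (map (ready b) (c1 @ x # c2)) (M @ map (ready b) (x # c2))" "swept b d1 M"
    "set M \<subseteq> scells" "c1 \<noteq> [] \<Longrightarrow> (\<exists>y. last_opt M = Some (Cell y (Swept b (residual R (level_word c1)))))"
    by blast
  let ?q = "residual R (level_word (c1 @ [x]))"
  let ?w = "map (\<lambda>y. Cell y (Swept b ?q)) w"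
  have q: "?q = delta (residual R (level_word c1)) x" by (simp add: delta_residual)
  have "srule (last_opt M) (ready b x) (hd_opt (map (ready b) c2)) ?w"
  proof (cases "c1 = []")
    case True
    then have "M = []" using d(2) M(2) by simp
    then show ?thesis using sweep_first[OF d(3)] True unfolding q by (simp add: residual_Nil)
  next
    case False
    then show ?thesis using M(4) sweep[OF d(3)] unfolding q by fastforce
  qed
  moreover have "set (M @ ready b x # map (ready b) c2) \<subseteq> scells"
    using M(3) snoc.prems(1) scellsI(1) by auto
  moreover have "set w \<subseteq> cells N T"
    using par_cells[OF rhs_syms, of "[x]" w] d(3) snoc.prems(1) by (simp add: par_single)
  then have w: "set ?w \<subseteq> scells" using scellsI(2) by auto
  moreover have "length ?w \<le> K" using expand_length[OF d(3)] by simp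
  ultimately have "nstep srules (M @ ready b x # map (ready b) c2) (M @ ?w @ map (ready b) c2)"
    by (rule nstepI)
  then have "(nstep srules)\<^sup>*\<^sup>* (map (ready b) ((c1 @ [x]) @ c2)) ((M @ ?w) @ map (ready b) c2)"
    using M(1) by simp
  moreover have "swept b d (M @ ?w)" unfolding d(1) using M(2) swept_map by (rule swept_append)
  moreover have "last_opt (M @ ?w) = Some (Cell (last w) (Swept b ?q))"
    using expand_nonempty[OF d(3)] by (simp add: last_opt_def last_map)
  ultimately show ?case using M(3) w by (intro exI[of _ "M @ ?w"]) simp
qed

text \<open>A nonempty \<open>c\<close> provides the ready right neighbour that
  \<open>unsweep\<close> needs. The rightmost cell, which undergoes the control test, is treated in
  \<open>reach_nsteps\<close>.\<close>

lemma back_complete: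
  assumes "swept b d M" "set M \<subseteq> scells" "set (d @ c) \<subseteq> cells N T" "c \<noteq> []"
  shows "(nstep srules)\<^sup>*\<^sup>* (M @ map (ready (\<not> b)) c) (map (ready (\<not> b)) (d @ c))"
  using assms
proof (induction M arbitrary: c d rule: rev_induct)
  case Nil
  then show ?case by simp
next
  case (snoc s M)
  obtain d1 y q where s: "d = d1 @ [y]" "s = Cell y (Swept b q)" "swept b d1 M"
    using snoc.prems(1) by (auto elim: swept_append2)
  obtain x c' where c: "c = x # c'" using snoc.prems(4) by (cases c) auto
  have "srule (last_opt M) s (hd_opt (map (ready (\<not> b)) c)) [ready (\<not> b) y]"
    unfolding s(2) c using unsweep by simp
  moreover have "set (M @ s # map (ready (\<not> b)) c) \<subseteq> scells" "set [ready (\<not> b) y] \<subseteq> scells"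
    using snoc.prems(2,3) s(1) scellsI(1) by auto
  moreover have "length [ready (\<not> b) y] \<le> K" by (simp add: K_def)
  ultimately have "nstep srules (M @ s # map (ready (\<not> b)) c) (M @ [ready (\<not> b) y] @ map (ready (\<not> b)) c)"
    by (rule nstepI)
  moreover have "(nstep srules)\<^sup>*\<^sup>* (M @ map (ready (\<not> b)) (y # c)) (map (ready (\<not> b)) (d1 @ y # c))"
    using snoc.prems s by (intro snoc.IH) auto
  ultimately show ?case using s(1) by simp
qed

lemma finish_complete:
  assumes "set (c1 @ c2) \<subseteq> cells N T" "spells c1 z"
  shows "(nstep srules)\<^sup>*\<^sup>* (map (ready b) (c1 @ c2)) (map Fin z @ map (ready b) c2)"
  using assms
proof (induction c1 arbitrary: c2 z rule: rev_induct)
  case Nil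
  then show ?case by (simp add: spells_def)
next
  case (snoc x c1)
  obtain z1 a where z: "z = z1 @ [a]" "spells c1 z1" "letter x a"
    using snoc.prems(2) unfolding spells_def by (auto simp: list_all2_append1 list_all2_Cons1)
  have T: "set z1 \<subseteq> T" "a \<in> T"
    using spells_cells[OF snoc.prems(2)] snoc.prems(1) z(1) by auto
  have "srule (last_opt (map Fin z1)) (ready b x) (hd_opt (map (ready b) c2)) [Fin a]"
  proof (cases z1 rule: rev_cases)
    case Nil
    then show ?thesis using finish_first[OF z(3)] by simp
  next
    case (snoc z2 a')
    then show ?thesis using finish[OF z(3)] by simp
  qed
  moreover have "set (map Fin z1 @ ready b x # map (ready b) c2) \<subseteq> scells" "set [Fin a] \<subseteq> scells"
    using T snoc.prems(1) scellsI by auto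
  moreover have "length [Fin a] \<le> K" by (simp add: K_def)
  ultimately have "nstep srules (map Fin z1 @ ready b x # map (ready b) c2) (map Fin z1 @ [Fin a] @ map (ready b) c2)"
    by (rule nstepI)
  moreover have "(nstep srules)\<^sup>*\<^sup>* (map (ready b) (c1 @ x # c2)) (map Fin z1 @ map (ready b) (x # c2))"
    using snoc.prems(1) z(2) by (intro snoc.IH) auto
  ultimately show ?case using z(1) by simp
qed

lemma reach_nsteps:
  "reaches c \<Longrightarrow> \<exists>b. (nstep srules)\<^sup>*\<^sup>* [ready False (Act (Nt S))] (map (ready b) c)"
proof (induction rule: reach.induct)
  case reach_start
  then show ?case by (intro exI[of _ False]) simp
next
  case (reach_par c d)
  then obtain b where b: "(nstep srules)\<^sup>*\<^sup>* [ready False (Act (Nt S))] (map (ready b) c)" by blast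
  have c: "set c \<subseteq> cells N T" "c \<noteq> []"
    using reach_cells[OF rhs_syms S_in reach_par(1)] reach_nonempty[OF reach_par(1)] by simp_all
  then have d: "set d \<subseteq> cells N T" using par_cells[OF rhs_syms reach_par(3)] by blast
  obtain M y where M: "(nstep srules)\<^sup>*\<^sup>* (map (ready b) c) M" "swept b d M" "set M \<subseteq> scells"
    "last_opt M = Some (Cell y (Swept b (residual R (level_word c))))"
    using sweep_complete[of c "[]" d b] c reach_par(3) by auto
  let ?s = "Cell y (Swept b (residual R (level_word c)))"
  obtain M' where M': "M = M' @ ?s # []" using M(4) by (cases M rule: rev_cases) auto
  then obtain d1 where d1: "d = d1 @ [y]" "swept b d1 M'"
    using M(2) by (auto elim: swept_append2)
  \<comment> \<open>The turn at the right end: the stored residual contains \<open>[]\<close>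
    because the level word lies in \<open>R\<close>.\<close>
  have "srule (last_opt M') ?s (hd_opt []) [ready (\<not> b) y]"
    using unsweep_last reach_par(2) by (simp add: residual_def)
  then have "nstep srules (M' @ ?s # []) (M' @ [ready (\<not> b) y] @ [])"
    by (rule nstepI) (use M(3) M' d d1 scellsI(1) in \<open>auto simp: K_def\<close>)
  moreover have "(nstep srules)\<^sup>*\<^sup>* (M' @ map (ready (\<not> b)) [y]) (map (ready (\<not> b)) (d1 @ [y]))"
    using d1 d M(3) M' by (intro back_complete) auto
  ultimately have "(nstep srules)\<^sup>*\<^sup>* [ready False (Act (Nt S))] (map (ready (\<not> b)) d)"
    using b M(1) unfolding M' d1(1) by auto
  then show ?case by blast
qed

lemma lang_in_CS: "tc_lang (N, T, P, S) R \<in> CS"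
proof -
  have "(\<exists>c. reaches c \<and> spells c z) \<longleftrightarrow>
      set z \<subseteq> T \<and> (nstep srules)\<^sup>*\<^sup>* [ready False (Act (Nt S))] (map Fin z)" for z
  proof
    assume "\<exists>c. reaches c \<and> spells c z"
    then obtain c where c: "reaches c" "spells c z" by blast
    then have cells: "set c \<subseteq> cells N T" using reach_cells[OF rhs_syms S_in] by blast
    obtain b where "(nstep srules)\<^sup>*\<^sup>* [ready False (Act (Nt S))] (map (ready b) c)"
      using reach_nsteps[OF c(1)] by blast
    moreover have "(nstep srules)\<^sup>*\<^sup>* (map (ready b) c) (map Fin z)"
      using finish_complete[of c "[]" z b] cells c(2) by simp
    moreover have "set z \<subseteq> T" using spells_cells[OF c(2) cells] .
    ultimately show "set z \<subseteq> T \<and> (nstep srules)\<^sup>*\<^sup>* [ready False (Act (Nt S))] (map Fin z)"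
      by (meson rtranclp_trans)
  qed (use sound in blast)
  then have "tc_lang (N, T, P, S) R =
      {z. set z \<subseteq> T \<and> (nstep srules)\<^sup>*\<^sup>* [ready False (Act (Nt S))] (map Fin z)} \<union>
      (if (S, []) \<in> P \<and> [Nt S] \<in> R then {[]} else {})"
    unfolding tc_lang_reach[OF G] by simp
  also have "\<dots> \<in> CS"
    using finite_srules finite_T srules_nonempty by (rule neighbour_system_in_CS)
  finally show ?thesis .
qed

end

lemma TC_subset_CS: "TC (RL_V k) \<subseteq> CS"
proof
  fix L :: "'t list set"
  assume "L \<in> TC (RL_V k)"
  then obtain N T P S R where "tc_grammar (N, T, P, S) R" and L: "L = tc_lang (N, T, P, S) R"
    unfolding TC_def by (auto simp: split_paired_Ex)
  then interpret tc_as_cs N T P S R by unfold_locales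
  show "L \<in> CS" using lang_in_CS L by simp
qed

theorem mainTheorem2:
  fixes n :: nat
  assumes "n \<ge> 1"
  shows "TC (RL_V n) = (CS :: 't list set set)"
  using TC_subset_CS CS_subset_TC[OF assms] by (rule equalityI)

end
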